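(* Let $\mathcal A=(A_1,\dots,A_t)$ and $\mathcal B=(B_1,\dots,B_t)$ be two $t$-tuples of $n\times n$ matrices over $\mathbb F$. (a) Let $\mathbb F$ be an algebraically closed field of characteristic different from $2$. Then $\mathcal A$ and $\mathcal B$ are symmetrically equivalent if and only if they are congruent. (b) Let $\mathbb F$ be a real closed field. Then $\mathcal A$ and $\mathcal B$ are symmetrically equivalent if and only if there exist $p\in\{0,1,\dots,n\}$ and a $t$-tuple $\mathcal C$ of $(p,n-p)$ block diagonal matrices over $\mathbb F$ such that $\mathcal A$ is congruent to $\mathcal C$ and $(I_p\oplus -I_{n-p})\,\mathcal C$ is congruent to $\mathcal B$. (c) Let $\mathbb F$ be an algebraically closed field or the skew field of real quaternions, and let a nonidentity involution on $\mathbb F$ be fixed. Then $\mathcal A$ and $\mathcal B$ are *symmetrically equivalent if and only if there exist $p\in\{0,1,\dots,n\}$ and a $t$-tuple $\mathcal C$ of $(p,n-p)$ block diagonal matrices over $\mathbb F$ such that $\mathcal A$ is *congruent to $\mathcal C$ and $(I_p\oplus -I_{n-p})\,\mathcal C$ is *congruent to $\mathcal B$.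
   Context: An involution on a field or skew field $\mathbb F$ is a bijection $a\mapsto\bar a$ of $\mathbb F$ (which can be the identity if $\mathbb F$ is a field) such that $\overline{a+b}=\bar a+\bar b$, $\overline{ab}=\bar b\,\bar a$ and $\bar{\bar a}=a$ for all $a,b\in\mathbb F$. For a matrix $A$ over $\mathbb F$, $A^*:=\bar A^T$ (conjugate transpose with respect to the fixed involution). For a tuple $\mathcal A=(A_1,\dots,A_t)$ and matrices $S,R$, write $S\mathcal A R:=(SA_1R,\dots,SA_tR)$ and $S\mathcal A:=(SA_1,\dots,SA_t)$; equality of tuples is componentwise. Two $t$-tuples $\mathcal A,\mathcal B$ of $n\times n$ matrices over $\mathbb F$ are: - symmetrically equivalent if $S\mathcal A R^T=R\mathcal A S^T=\mathcal B$ for some nonsingular $n\times n$ matrices $S,R$ over $\mathbb F$; - *symmetrically equivalent if $S\mathcal A R^*=R\mathcal A S^*=\mathcal B$ for some nonsingular $S,R$; - congruent if $S\mathcal A S^T=\mathcal B$ for some nonsingular $S$; - *congruent if $S\mathcal A S^*=\mathcal B$ for some nonsingular $S$. For $p,q\in\{0,1,2,\dots\}$, a $(p,q)$ block diagonal matrix is a matrix of the form $\begin{bmatrix}A&0\\0&B\end{bmatrix}$ with $A$ of size $p\times p$ and $B$ of size $q\times q$. $I_p\oplus -I_{n-p}$ denotes the block diagonal matrix with diagonal blocks $I_p$ and $-I_{n-p}$. A real closed field is a field whose algebraic closure is two-dimensional over it. *)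

theory Defs
  imports
    "Jordan_Normal_Form.Matrix"
    "HOL-Algebra.Algebraic_Closure_Type"
    Complex_Main
begin

section \<open>Real closed fields\<close>

text \<open>The algebraic closure is regarded as a vector space over the image of the field under
  the canonical embedding.\<close>

definition ac_scale :: "'a::field \<Rightarrow> 'a alg_closure \<Rightarrow> 'a alg_closure" where
  "ac_scale c x = to_ac c * x"

lemma vector_space_ac_scale: "vector_space (ac_scale :: 'a::field \<Rightarrow> 'a alg_closure \<Rightarrow> 'a alg_closure)"
  by unfold_locales (simp_all add: ac_scale_def algebra_simps)

definition is_real_closed :: "'a::field itself \<Rightarrow> bool" where
  "is_real_closed _ \<longleftrightarrow>
     vector_space.dim (ac_scale :: 'a \<Rightarrow> 'a alg_closure \<Rightarrow> 'a alg_closure) UNIV = 2"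


section \<open>Real quaternions\<close>

text \<open>\<open>Quat a b c d\<close> represents the quaternion $a + bi + cj + dk$.\<close>

datatype quat = Quat (q_1: real) (q_i: real) (q_j: real) (q_k: real)

instantiation quat :: division_ring
begin

definition zero_quat :: quat where "0 = Quat 0 0 0 0"

definition one_quat :: quat where "1 = Quat 1 0 0 0"

definition plus_quat :: "quat \<Rightarrow> quat \<Rightarrow> quat" where
  "x + y = Quat (q_1 x + q_1 y) (q_i x + q_i y) (q_j x + q_j y) (q_k x + q_k y)"

definition uminus_quat :: "quat \<Rightarrow> quat" where
  "- x = Quat (- q_1 x) (- q_i x) (- q_j x) (- q_k x)"

definition minus_quat :: "quat \<Rightarrow> quat \<Rightarrow> quat" where
  "x - y = Quat (q_1 x - q_1 y) (q_i x - q_i y) (q_j x - q_j y) (q_k x - q_k y)"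

definition times_quat :: "quat \<Rightarrow> quat \<Rightarrow> quat" where
  "x * y = Quat
     (q_1 x * q_1 y - q_i x * q_i y - q_j x * q_j y - q_k x * q_k y)
     (q_1 x * q_i y + q_i x * q_1 y + q_j x * q_k y - q_k x * q_j y)
     (q_1 x * q_j y - q_i x * q_k y + q_j x * q_1 y + q_k x * q_i y)
     (q_1 x * q_k y + q_i x * q_j y - q_j x * q_i y + q_k x * q_1 y)"

definition inverse_quat :: "quat \<Rightarrow> quat" where
  "inverse x = (let N = (q_1 x)\<^sup>2 + (q_i x)\<^sup>2 + (q_j x)\<^sup>2 + (q_k x)\<^sup>2
                in Quat (q_1 x / N) (- q_i x / N) (- q_j x / N) (- q_k x / N))"

definition divide_quat :: "quat \<Rightarrow> quat \<Rightarrow> quat" where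
  "divide_quat x y = x * inverse y"

instance
proof
  fix a b c :: quat
  show "a * b * c = a * (b * c)" "(a + b) * c = a * c + b * c" "a * (b + c) = a * b + a * c"
    by (simp_all add: times_quat_def plus_quat_def algebra_simps)
  {
    assume "a \<noteq> 0"
    define N where "N = (q_1 a)\<^sup>2 + (q_i a)\<^sup>2 + (q_j a)\<^sup>2 + (q_k a)\<^sup>2"
    have "N \<noteq> 0"
    proof
      assume "N = 0"
      hence "q_1 a = 0 \<and> q_i a = 0 \<and> q_j a = 0 \<and> q_k a = 0"
        unfolding N_def by (smt (verit) zero_le_power2 power2_eq_iff_nonneg zero_eq_power2)
      with \<open>a \<noteq> 0\<close> show False
        by (cases a) (simp add: zero_quat_def)
    qed
    moreover have inv: "inverse a = Quat (q_1 a / N) (- q_i a / N) (- q_j a / N) (- q_k a / N)"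
      by (simp add: inverse_quat_def N_def Let_def)
    ultimately show "inverse a * a = 1" "a * inverse a = 1"
      unfolding inv times_quat_def one_quat_def
      by (simp_all add: field_simps, simp_all add: N_def power2_eq_square algebra_simps)
  }
qed (simp_all add: zero_quat_def one_quat_def plus_quat_def uminus_quat_def minus_quat_def
       times_quat_def inverse_quat_def divide_quat_def)

end


section \<open>Involutions\<close>

definition involution :: "('a::division_ring \<Rightarrow> 'a) \<Rightarrow> bool" where
  "involution \<sigma> \<longleftrightarrow> bij \<sigma> \<and>
     (\<forall>a b. \<sigma> (a + b) = \<sigma> a + \<sigma> b) \<and>
     (\<forall>a b. \<sigma> (a * b) = \<sigma> b * \<sigma> a) \<and>
     (\<forall>a. \<sigma> (\<sigma> a) = a)"

definition conj_transpose :: "('a \<Rightarrow> 'a) \<Rightarrow> 'a mat \<Rightarrow> 'a mat" where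
  "conj_transpose \<sigma> A = transpose_mat (map_mat \<sigma> A)"


section \<open>Tuples of matrices\<close>

definition mat_tuples :: "nat \<Rightarrow> nat \<Rightarrow> 'a mat list set" where
  "mat_tuples t n = {As. length As = t \<and> set As \<subseteq> carrier_mat n n}"

definition lmult_tuple :: "'a::semiring_0 mat \<Rightarrow> 'a mat list \<Rightarrow> 'a mat list" where
  "lmult_tuple S As = map (\<lambda>A. S * A) As"

definition mult_tuple :: "'a::semiring_0 mat \<Rightarrow> 'a mat list \<Rightarrow> 'a mat \<Rightarrow> 'a mat list" where
  "mult_tuple S As R = map (\<lambda>A. S * A * R) As"

definition nonsingular :: "nat \<Rightarrow> 'a::division_ring mat \<Rightarrow> bool" where
  "nonsingular n S \<longleftrightarrow> S \<in> carrier_mat n n \<and> invertible_mat S"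

definition sym_equivalent :: "nat \<Rightarrow> 'a::field mat list \<Rightarrow> 'a mat list \<Rightarrow> bool" where
  "sym_equivalent n As Bs \<longleftrightarrow> (\<exists>S R. nonsingular n S \<and> nonsingular n R \<and>
     mult_tuple S As (transpose_mat R) = Bs \<and> mult_tuple R As (transpose_mat S) = Bs)"

definition congruent_tuples :: "nat \<Rightarrow> 'a::field mat list \<Rightarrow> 'a mat list \<Rightarrow> bool" where
  "congruent_tuples n As Bs \<longleftrightarrow> (\<exists>S. nonsingular n S \<and> mult_tuple S As (transpose_mat S) = Bs)"

definition star_sym_equivalent ::
    "('a::division_ring \<Rightarrow> 'a) \<Rightarrow> nat \<Rightarrow> 'a mat list \<Rightarrow> 'a mat list \<Rightarrow> bool" where
  "star_sym_equivalent \<sigma> n As Bs \<longleftrightarrow> (\<exists>S R. nonsingular n S \<and> nonsingular n R \<and>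
     mult_tuple S As (conj_transpose \<sigma> R) = Bs \<and> mult_tuple R As (conj_transpose \<sigma> S) = Bs)"

definition star_congruent ::
    "('a::division_ring \<Rightarrow> 'a) \<Rightarrow> nat \<Rightarrow> 'a mat list \<Rightarrow> 'a mat list \<Rightarrow> bool" where
  "star_congruent \<sigma> n As Bs \<longleftrightarrow>
     (\<exists>S. nonsingular n S \<and> mult_tuple S As (conj_transpose \<sigma> S) = Bs)"


section \<open>Block diagonal matrices\<close>

definition direct_sum :: "'a::zero mat \<Rightarrow> 'a mat \<Rightarrow> 'a mat" where
  "direct_sum A B =
     four_block_mat A (0\<^sub>m (dim_row A) (dim_col B)) (0\<^sub>m (dim_row B) (dim_col A)) B"

definition block_diagonal :: "nat \<Rightarrow> nat \<Rightarrow> 'a::zero mat \<Rightarrow> bool" where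
  "block_diagonal p q M \<longleftrightarrow>
     (\<exists>A \<in> carrier_mat p p. \<exists>B \<in> carrier_mat q q. M = direct_sum A B)"

definition sign_mat :: "nat \<Rightarrow> nat \<Rightarrow> 'a::ring_1 mat" where
  "sign_mat p q = direct_sum (1\<^sub>m p) (- 1\<^sub>m q)"

end

theory Submission
  imports Defs "Jordan_Normal_Form.Char_Poly"
begin

text \<open>
The equations \<open>S A R\<^sup>* = R A S\<^sup>* = B\<close> say, with \<open>M = R\<^sup>-\<^sup>1 S\<close>, that \<open>M A = A M\<^sup>*\<close> and that \<open>B\<close> is
congruent to \<open>M A\<close>, with a congruence that does not depend on the member \<open>A\<close> of the tuple. If \<open>F\<close>
is a polynomial in \<open>M\<close> with central coefficients fixed by the involution, then \<open>F A = A F\<^sup>*\<close>. So if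
\<open>M\<close> were the square of such an \<open>F\<close>, then \<open>M A = F A F\<^sup>*\<close> would be congruent to \<open>A\<close>. In general the
eigenvalues in the fixed field are squares only up to sign, and instead
\<open>M = F G F\<close> for polynomials \<open>F\<close> and \<open>G\<close> in \<open>M\<close> with \<open>G\<^sup>2 = 1\<close> (\<open>signed_sqrt_mat\<close>). Then \<open>M A\<close> is
congruent to \<open>G A\<close>. The involution \<open>G\<close> is similar to a sign matrix \<open>J\<close>
(\<open>square_one_similar_to_sign\<close>), and in the corresponding basis \<open>G A = A G\<^sup>*\<close> means that the transformed
\<open>A\<close> commutes with \<open>J\<close>, which is to say that it is block diagonal. Over an algebraically closed field
with the identity involution, \<open>G\<close> has a square root that is a polynomial in \<open>G\<close>, and it is absorbed
in the same way.

The polynomials come from \<open>signed_sqrt_mod_poly\<close>: modulo an annihilating polynomial of \<open>M\<close>,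
equivariant interpolation provides signed square roots at the eigenvalues, and Newton iteration
takes care of multiplicities. To treat all cases at once, the polynomials are taken over an
algebraically closed field with an involution \<open>\<tau>\<close>, and their coefficients are required to be fixed by
\<open>\<tau>\<close>: for a real closed field this is the conjugation of its algebraic closure
(\<open>real_closed_conjugation\<close>), for the quaternions it is complex conjugation, and otherwise it is the
given involution itself. What is needed of \<open>\<tau>\<close> is that fixed elements have fixed square roots up
to sign, which is the elementary part of the Artin-Schreier theorem
(\<open>signed_sqrt_field_nonidentity\<close>).
\<close>


section \<open>Square roots modulo a polynomial\<close>

lemma interpolating_poly_exists:
  fixes v :: "'a::field \<Rightarrow> 'a"
  assumes "finite S"
  shows "\<exists>p. \<forall>x\<in>S. poly p x = v x"
  using assms
proof (induction S)
  case empty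
  show ?case by simp
next
  case (insert a S)
  then obtain p where p: "\<forall>x\<in>S. poly p x = v x" by blast
  define N where "N = (\<Prod>y\<in>S. [:-y, 1:])"
  have N: "poly N x = (\<Prod>y\<in>S. x - y)" for x
    by (simp add: N_def poly_prod)
  have "poly N a \<noteq> 0" using insert by (auto simp: N)
  moreover have "poly N x = 0" if "x \<in> S" for x
    using that insert(1) by (auto simp: N)
  ultimately have "\<forall>x\<in>insert a S. poly (p + smult ((v a - poly p a) / poly N a) N) x = v x"
    using p by auto
  then show ?case by blast
qed

text \<open>The Nullstellensatz in one variable. It turns agreement at the roots of \<open>m\<close> into nilpotency
modulo \<open>m\<close>, which is what the Newton iteration below starts from.\<close>

lemma dvd_power_if_roots_subset:
  fixes m q :: "'a::alg_closed_field poly"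
  assumes "m \<noteq> 0" "\<And>x. poly m x = 0 \<Longrightarrow> poly q x = 0"
  shows "\<exists>k. m dvd q ^ k"
  using assms
proof (induction "degree m" arbitrary: m)
  case 0
  then have "m dvd q ^ 0" by (auto elim!: degree_eq_zeroE simp: is_unit_const_poly_iff)
  then show ?case by blast
next
  case (Suc d)
  then obtain a where a: "poly m a = 0"
    using alg_closed_imp_poly_has_root[of m] by auto
  then obtain m' where m': "m = [:-a, 1:] * m'"
    using poly_eq_0_iff_dvd by (metis dvdE)
  have "m' \<noteq> 0" using Suc.prems m' by auto
  have "degree m = degree [:-a, 1:] + degree m'"
    unfolding m' by (rule degree_mult_eq) (use \<open>m' \<noteq> 0\<close> in auto)
  then have "d = degree m'" using Suc.hyps(2) by simp
  moreover have "poly q x = 0" if "poly m' x = 0" for x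
    using Suc.prems(2)[of x] that m' by simp
  ultimately obtain k where "m' dvd q ^ k" using Suc.hyps(1) \<open>m' \<noteq> 0\<close> by blast
  moreover have "[:-a, 1:] dvd q" using Suc.prems(2)[OF a] poly_eq_0_iff_dvd by blast
  ultimately have "m dvd q ^ Suc k" unfolding m' by (simp only: power_Suc mult_dvd_mono)
  then show ?case by blast
qed

text \<open>One Newton step for the inverse square root replaces \<open>w\<close> by \<open>w (3 - u) / 2\<close>, where \<open>u = h w\<^sup>2\<close>
is to become \<open>1\<close>; here \<open>c\<close> stands for one half. The error of the new \<open>u\<close> is a multiple of the
square of the old error.\<close>

lemma newton_step_identity:
  fixes c u :: "'a::comm_ring_1"
  assumes "2 * c = 1"
  shows "c * c * (u * (3 - u)\<^sup>2) - 1 = (u - 1)\<^sup>2 * (c * c * (u - 4))"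
proof -
  have "1 = (2 * c) * (2 * c)" using assms by simp
  then have one: "1 = 4 * (c * c)" by (simp add: algebra_simps)
  have "c * c * (u * (3 - u)\<^sup>2) - 4 * (c * c) = (u - 1)\<^sup>2 * (c * c * (u - 4))"
    by (simp add: power2_eq_square algebra_simps)
  with one show ?thesis by simp
qed

text \<open>The map \<open>\<tau>\<close> is either the identity or plays the role of complex conjugation. In the second case
its fixed elements form a real closed field, and the last axiom says that each of them is a square
up to sign; if \<open>\<tau>\<close> is the identity, the sign can be taken to be \<open>1\<close>. Treating the fixed field as a
subset, and not as a type, lets one argument serve all the cases.\<close>

locale signed_sqrt_field =
  fixes \<tau> :: "'k::alg_closed_field \<Rightarrow> 'k"
  assumes tau_add: "\<tau> (x + y) = \<tau> x + \<tau> y"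
    and tau_mult: "\<tau> (x * y) = \<tau> x * \<tau> y"
    and tau_tau [simp]: "\<tau> (\<tau> x) = x"
    and two_neq_0: "(2::'k) \<noteq> 0"
    and signed_sqrt_fixed: "\<tau> x = x \<Longrightarrow> \<exists>s e. \<tau> s = s \<and> (e = 1 \<or> e = -1) \<and> s * s = e * x"
begin

lemma tau_0 [simp]: "\<tau> 0 = 0"
  using tau_add[of 0 0] by (metis add_cancel_right_right)

lemma tau_1 [simp]: "\<tau> 1 = 1"
proof -
  have "\<tau> 1 \<noteq> 0" by (metis tau_0 tau_tau zero_neq_one)
  moreover have "\<tau> 1 * \<tau> 1 = \<tau> 1" using tau_mult[of 1 1] by simp
  ultimately show ?thesis by simp
qed

sublocale tau: comm_ring_hom \<tau>
  by unfold_locales (simp_all add: tau_add tau_mult)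

sublocale tau_poly: map_poly_comm_ring_hom \<tau> ..

lemma tau_inverse: "\<tau> (inverse x) = inverse (\<tau> x)"
proof (cases "x = 0")
  case False
  have "\<tau> x * \<tau> (inverse x) = 1" using False by (simp flip: tau_mult)
  then show ?thesis by (metis inverse_unique)
qed simp

text \<open>The polynomials over the fixed field of \<open>\<tau>\<close>.\<close>

definition sym_poly :: "'k poly \<Rightarrow> bool" where
  "sym_poly p \<longleftrightarrow> map_poly \<tau> p = p"

lemma map_tau_map_tau [simp]: "map_poly \<tau> (map_poly \<tau> p) = p"
  by (rule poly_eqI) simp

lemma poly_map_tau: "poly (map_poly \<tau> p) x = \<tau> (poly p (\<tau> x))"
  using tau.poly_map_poly[of p "\<tau> x"] by simp

lemma sym_poly_pCons: "sym_poly (pCons a p) \<longleftrightarrow> \<tau> a = a \<and> sym_poly p"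
  by (simp add: sym_poly_def tau.map_poly_pCons_hom)

lemma sym_poly_0 [simp]: "sym_poly 0" and sym_poly_1 [simp]: "sym_poly 1"
  by (simp_all add: sym_poly_def)

lemma sym_poly_add: "sym_poly p \<Longrightarrow> sym_poly q \<Longrightarrow> sym_poly (p + q)"
  and sym_poly_diff: "sym_poly p \<Longrightarrow> sym_poly q \<Longrightarrow> sym_poly (p - q)"
  and sym_poly_mult: "sym_poly p \<Longrightarrow> sym_poly q \<Longrightarrow> sym_poly (p * q)"
  and sym_poly_smult: "\<tau> c = c \<Longrightarrow> sym_poly p \<Longrightarrow> sym_poly (smult c p)"
  by (simp_all add: sym_poly_def hom_distribs tau_poly.hom_mult tau_poly.hom_minus)

lemma sym_poly_monom: "\<tau> c = c \<Longrightarrow> sym_poly (monom c d)"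
  by (simp add: sym_poly_def)

lemma tau_half: "\<tau> (1/2) = 1/2"
proof -
  have "\<tau> 2 = 2"
    using tau_add[of 1 1] by simp
  then show ?thesis
    using tau_inverse[of 2] by (simp add: inverse_eq_divide)
qed

lemma sym_poly_quotient:
  assumes "sym_poly m" "sym_poly (m * r)" "m \<noteq> 0"
  shows "sym_poly r"
proof -
  have "m * map_poly \<tau> r = m * r"
    using assms(1,2) unfolding sym_poly_def by (metis tau_poly.hom_mult)
  then show ?thesis using assms(3) by (simp add: sym_poly_def)
qed

lemma poly_tau_root: "sym_poly m \<Longrightarrow> poly m (\<tau> x) = 0 \<longleftrightarrow> poly m x = 0"
  using poly_map_tau[of m x] by (metis sym_poly_def tau_0 tau_tau)

text \<open>Averaging any interpolating polynomial with its \<open>\<tau>\<close>-conjugate does not change its values on \<open>S\<close>,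
because the prescribed values are equivariant.\<close>

lemma sym_interpolating_poly_exists:
  assumes "finite S" "\<And>x. x \<in> S \<Longrightarrow> \<tau> x \<in> S" "\<And>x. x \<in> S \<Longrightarrow> v (\<tau> x) = \<tau> (v x)"
  shows "\<exists>p. sym_poly p \<and> (\<forall>x\<in>S. poly p x = v x)"
proof -
  obtain p where p: "\<forall>x\<in>S. poly p x = v x"
    using interpolating_poly_exists[OF assms(1)] by blast
  define q where "q = smult (1/2) (p + map_poly \<tau> p)"
  have "sym_poly q"
    by (simp add: sym_poly_def q_def hom_distribs tau_half add.commute del: div_by_1)
  moreover have "poly q x = v x" if "x \<in> S" for x
  proof -
    have "poly q x = 1/2 * (v x + \<tau> (v (\<tau> x)))"
      using that assms(2) p by (simp add: q_def poly_map_tau)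
    also have "\<dots> = v x" using that assms(3) two_neq_0 by simp
    finally show ?thesis .
  qed
  ultimately show ?thesis by blast
qed

text \<open>Iterating for the inverse square root and not for the square root avoids every division modulo
\<open>m\<close>: the step only uses ring operations and one half, so it stays within symmetric polynomials. The
exponent is halved until it is at most \<open>1\<close>. Each step fixes the values at the roots of \<open>m\<close>, since
\<open>(3 - u) / 2\<close> is \<open>1\<close> where \<open>u\<close> is.\<close>

lemma newton_inverse_sqrt:
  assumes "sym_poly h" "sym_poly w"
    and "\<And>x. poly m x = 0 \<Longrightarrow> poly h x * poly w x * poly w x = 1"
    and "m dvd (h * w * w - 1) ^ k"
  shows "\<exists>w'. sym_poly w' \<and> (\<forall>x. poly m x = 0 \<longrightarrow> poly w' x = poly w x) \<and> m dvd h * w' * w' - 1"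
  using assms
proof (induction k arbitrary: w rule: less_induct)
  case (less k)
  consider "k = 0" | "k = 1" | "k \<ge> 2" by linarith
  then show ?case
  proof cases
    case 1
    then have "m dvd 1" using less.prems(4) by simp
    then have "m dvd h * w * w - 1" by (rule dvd_trans) simp
    then show ?thesis using less.prems by blast
  next
    case 2
    then show ?thesis using less.prems by auto
  next
    case 3
    define c where "c = [:1/2 :: 'k:]"
    have c: "2 * c = 1"
      using two_neq_0 by (simp add: c_def numeral_poly one_pCons)
    define u where "u = h * w * w"
    define w1 where "w1 = c * w * (3 - u)"
    have symc: "sym_poly c" by (simp add: c_def sym_poly_pCons tau_half del: div_by_1)
    have "sym_poly 3"
      using sym_poly_add[OF sym_poly_1 sym_poly_add[OF sym_poly_1 sym_poly_1]] by simp
    then have sym1: "sym_poly w1"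
      unfolding w1_def u_def by (intro sym_poly_mult sym_poly_diff symc less.prems)
    have val: "poly w1 x = poly w x" if "poly m x = 0" for x
      using less.prems(3)[OF that] two_neq_0
      by (simp add: w1_def c_def u_def mult.assoc)
    have "h * w1 * w1 - 1 = c * c * (u * (3 - u)\<^sup>2) - 1"
      by (simp add: w1_def u_def power2_eq_square algebra_simps)
    also have "\<dots> = (u - 1)\<^sup>2 * (c * c * (u - 4))"
      by (rule newton_step_identity[OF c])
    finally have step: "h * w1 * w1 - 1 = (u - 1)\<^sup>2 * (c * c * (u - 4))" .
    (* Rounding up makes 2 * j at least k; it is still smaller than k, as k is at least 2. *)
    define j where "j = (k + 1) div 2"
    have "m dvd (u - 1) ^ k" using less.prems(4) by (simp add: u_def)
    also have "(u - 1) ^ k dvd ((u - 1)\<^sup>2) ^ j"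
      unfolding power_mult[symmetric] by (rule le_imp_power_dvd) (simp add: j_def)
    also have "\<dots> dvd (h * w1 * w1 - 1) ^ j"
      unfolding step by (simp add: power_mult_distrib)
    finally have dvd: "m dvd (h * w1 * w1 - 1) ^ j" .
    have "j < k" using 3 by (simp add: j_def)
    from less.IH[OF this less.prems(1) sym1 _ dvd] less.prems(3) val
    show ?thesis by simp
  qed
qed

text \<open>Interpolation solves the problem at the roots of \<open>m\<close>, and Newton iteration lifts the solution to
the multiplicities of the roots.\<close>

lemma sqrt_mod_poly:
  assumes "m \<noteq> 0" "sym_poly m" "sym_poly h"
    and "\<And>x. poly m x = 0 \<Longrightarrow> poly h x \<noteq> 0 \<and> s x * s x = poly h x \<and> s (\<tau> x) = \<tau> (s x)"
  shows "\<exists>f. sym_poly f \<and> m dvd f * f - h \<and> (\<forall>x. poly m x = 0 \<longrightarrow> poly f x = s x)"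
proof -
  let ?S = "{x. poly m x = 0}"
  have "finite ?S" using assms(1) by (rule poly_roots_finite)
  then obtain w where w: "sym_poly w" "\<forall>x\<in>?S. poly w x = inverse (s x)"
    using sym_interpolating_poly_exists[of ?S "\<lambda>x. inverse (s x)"] assms
    by (auto simp: poly_tau_root tau_inverse)
  have root: "poly h x * poly w x * poly w x = 1" if "poly m x = 0" for x
  proof -
    have "poly w x = inverse (s x)" "poly h x = s x * s x" "s x \<noteq> 0"
      using w(2) assms(4)[OF that] that by auto
    then show ?thesis by (simp add: field_simps)
  qed
  then obtain k where "m dvd (h * w * w - 1) ^ k"
    using dvd_power_if_roots_subset[OF assms(1), of "h * w * w - 1"] by auto
  from newton_inverse_sqrt[OF assms(3) w(1) root this]
  obtain w' where w': "sym_poly w'" "\<And>x. poly m x = 0 \<Longrightarrow> poly w' x = poly w x"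
    "m dvd h * w' * w' - 1"
    by blast
  have "h * w' * (h * w') - h = h * (h * w' * w' - 1)" by (simp add: algebra_simps)
  then have "m dvd h * w' * (h * w') - h" using w'(3) by (simp add: dvd_mult)
  moreover have "poly (h * w') x = s x" if "poly m x = 0" for x
  proof -
    have "poly h x = s x * s x" "s x \<noteq> 0" using assms(4)[OF that] by auto
    then show ?thesis using w'(2)[OF that] w(2) that by simp
  qed
  ultimately show ?thesis using sym_poly_mult[OF assms(3) w'(1)] by blast
qed

text \<open>On a two-element orbit \<open>{x, \<tau> x}\<close> a root is chosen at one representative and transported to the
other point; at fixed points the signed root can be taken fixed.\<close>

lemma equivariant_signed_sqrt:
  "\<exists>s e. \<forall>x. s (\<tau> x) = \<tau> (s x) \<and> e (\<tau> x) = e x \<and> (e x = 1 \<or> e x = -1) \<and> s x * s x = e x * x"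
proof -
  have "\<exists>t d. (d = 1 \<or> d = -1) \<and> t * t = d * x \<and> (\<tau> x = x \<longrightarrow> \<tau> t = t)" for x
  proof (cases "\<tau> x = x")
    case True
    then show ?thesis using signed_sqrt_fixed by blast
  next
    case False
    obtain y where "y ^ 2 = x" using nth_root_exists[of 2 x] by auto
    then show ?thesis using False by (intro exI[of _ y] exI[of _ 1]) (simp add: power2_eq_square)
  qed
  then obtain t d where td: "\<And>x. d x = 1 \<or> d x = -1" "\<And>x. t x * t x = d x * x"
    "\<And>x. \<tau> x = x \<Longrightarrow> \<tau> (t x) = t x"
    by metis
  define rep where "rep x = (SOME y. y \<in> {x, \<tau> x})" for x
  have rep: "rep x = x \<or> rep x = \<tau> x" for x
    using someI[of "\<lambda>y. y \<in> {x, \<tau> x}" x] by (auto simp: rep_def)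
  have rep_tau: "rep (\<tau> x) = rep x" for x
    by (simp add: rep_def insert_commute)
  define s where "s x = (if rep x = x then t x else \<tau> (t (\<tau> x)))" for x
  define e where "e x = d (rep x)" for x
  have "s (\<tau> x) = \<tau> (s x)" for x
    using rep[of x] rep_tau[of x] td(3)[of x] by (auto simp: s_def)
  moreover have "s x * s x = e x * x" for x
  proof (cases "rep x = x")
    case True
    then show ?thesis by (simp add: s_def e_def td(2))
  next
    case False
    then have r: "rep x = \<tau> x" using rep[of x] by simp
    have "s x * s x = \<tau> (t (\<tau> x) * t (\<tau> x))" using False by (simp add: s_def tau_mult)
    also have "\<dots> = \<tau> (d (\<tau> x)) * x" by (simp add: td(2) tau_mult)
    also have "\<tau> (d (\<tau> x)) = d (\<tau> x)"
      using td(1)[of "\<tau> x"] by (auto simp: hom_distribs)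
    finally show ?thesis by (simp add: e_def r)
  qed
  ultimately show ?thesis
    using td(1) by (intro exI[of _ s] exI[of _ e]) (auto simp: e_def rep_tau)
qed

text \<open>In the algebra of polynomials modulo \<open>m\<close>, in which the variable is a unit, the variable is a
square up to the factor \<open>g\<close> with \<open>g\<^sup>2 = 1\<close>. At each root of \<open>m\<close> the factor is the sign that the root
needs. It is constructed first, as a square root of \<open>1\<close> with these prescribed values, so that \<open>f\<close>
can then be obtained as a square root of the product of \<open>g\<close> and the variable.\<close>

theorem signed_sqrt_mod_poly:
  assumes "m \<noteq> 0" "sym_poly m" "poly m 0 \<noteq> 0"
  shows "\<exists>f g. sym_poly f \<and> sym_poly g \<and> m dvd g * g - 1 \<and> m dvd f * f - g * [:0, 1:]"
proof -
  obtain s e where se: "\<And>x. s (\<tau> x) = \<tau> (s x)" "\<And>x. e (\<tau> x) = e x"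
    "\<And>x. e x = 1 \<or> e x = -1" "\<And>x. s x * s x = e x * x"
    using equivariant_signed_sqrt by blast
  have taue: "\<tau> (e x) = e x" for x using se(3)[of x] by (auto simp: hom_distribs)
  have "e x * e x = 1" for x using se(3)[of x] by auto
  then obtain g where g: "sym_poly g" "m dvd g * g - 1" "\<And>x. poly m x = 0 \<Longrightarrow> poly g x = e x"
    using sqrt_mod_poly[OF assms(1,2) sym_poly_1, of e] se(2) taue by auto
  have "sym_poly (g * [:0, 1:])"
    by (intro sym_poly_mult g) (simp add: sym_poly_pCons)
  moreover have "poly (g * [:0, 1:]) x \<noteq> 0 \<and> s x * s x = poly (g * [:0, 1:]) x \<and> s (\<tau> x) = \<tau> (s x)"
    if "poly m x = 0" for x
  proof -
    have "x \<noteq> 0" using that assms(3) by auto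
    moreover have "e x \<noteq> 0" using se(3)[of x] by auto
    ultimately show ?thesis using g(3)[OF that] se(1,4) by simp
  qed
  ultimately obtain f where "sym_poly f" "m dvd f * f - g * [:0, 1:]"
    using sqrt_mod_poly[OF assms(1,2)] by blast
  then show ?thesis using g by blast
qed

text \<open>Finitely many linear conditions over the fixed field cannot exclude all nonzero symmetric
polynomials. The bound on the degree makes the induction work: two common zeros of the earlier
functionals with different degrees are linearly independent, so a combination of them that kills
one more functional is nonzero.\<close>

lemma functionals_vanish_on_sym_poly:
  fixes \<phi> :: "'i \<Rightarrow> 'k poly \<Rightarrow> 'k"
  assumes "finite I"
    and "\<And>i p. \<tau> (\<phi> i p) = \<phi> i p"
    and "\<And>i p q. sym_poly p \<Longrightarrow> sym_poly q \<Longrightarrow> \<phi> i (p + q) = \<phi> i p + \<phi> i q"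
    and "\<And>i c p. \<tau> c = c \<Longrightarrow> sym_poly p \<Longrightarrow> \<phi> i (smult c p) = c * \<phi> i p"
  shows "\<exists>p. sym_poly p \<and> p \<noteq> 0 \<and> degree p \<ge> d \<and> (\<forall>i\<in>I. \<phi> i p = 0)"
  using assms(1)
proof (induction I arbitrary: d)
  case empty
  show ?case
    by (intro exI[of _ "monom 1 d"]) (simp add: sym_poly_monom degree_monom_eq)
next
  case (insert a I)
  obtain p where p: "sym_poly p" "p \<noteq> 0" "degree p \<ge> d" "\<forall>i\<in>I. \<phi> i p = 0"
    using insert.IH by blast
  obtain q where q: "sym_poly q" "q \<noteq> 0" "degree q \<ge> Suc (degree p)" "\<forall>i\<in>I. \<phi> i q = 0"
    using insert.IH by blast
  show ?case
  proof (cases "\<phi> a p = 0")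
    case True
    then show ?thesis using p by blast
  next
    case False
    let ?c = "\<phi> a p" and ?e = "- \<phi> a q"
    define r where "r = smult ?c q + smult ?e p"
    have fixed: "\<tau> ?c = ?c" "\<tau> ?e = ?e" by (simp_all add: assms(2) hom_distribs)
    have "degree r = degree q"
      unfolding r_def using False q(3)
      by (subst degree_add_eq_left) (auto intro: le_less_trans[OF degree_smult_le])
    moreover have "\<phi> i r = ?c * \<phi> i q + ?e * \<phi> i p" for i
      unfolding r_def
      by (simp only: assms(3)[OF sym_poly_smult[OF fixed(1) q(1)] sym_poly_smult[OF fixed(2) p(1)]]
          assms(4)[OF fixed(1) q(1)] assms(4)[OF fixed(2) p(1)])
    moreover have "sym_poly r"
      unfolding r_def by (intro sym_poly_add sym_poly_smult fixed p q)
    ultimately show ?thesis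
      using p q by (intro exI[of _ r]) auto
  qed
qed

end


section \<open>Matrices over a skew field\<close>

text \<open>In this and the following sections the entries need not commute: scalars act from the left, and
only central scalars can be moved through a product.\<close>

lemma mult_smult_assoc_mat_noncomm:
  fixes A B :: "'a::semiring_0 mat"
  assumes "A \<in> carrier_mat nr n" "B \<in> carrier_mat n nc"
  shows "(c \<cdot>\<^sub>m A) * B = c \<cdot>\<^sub>m (A * B)"
  using assms by (intro eq_matI) (auto simp: scalar_prod_def sum_distrib_left mult.assoc)

lemma mult_smult_distrib_central:
  fixes A B :: "'a::semiring_0 mat"
  assumes "\<And>x. c * x = x * c" "A \<in> carrier_mat nr n" "B \<in> carrier_mat n nc"
  shows "A * (c \<cdot>\<^sub>m B) = c \<cdot>\<^sub>m (A * B)"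
proof (intro eq_matI)
  fix i j
  assume "i < dim_row (c \<cdot>\<^sub>m (A * B))" "j < dim_col (c \<cdot>\<^sub>m (A * B))"
  moreover have "x * (c * y) = c * (x * y)" for x y
    using assms(1)[of x] by (metis mult.assoc)
  ultimately show "(A * (c \<cdot>\<^sub>m B)) $$ (i, j) = (c \<cdot>\<^sub>m (A * B)) $$ (i, j)"
    using assms(2,3) by (auto simp: scalar_prod_def sum_distrib_left)
qed (use assms in auto)

lemma nonsingular_iff:
  "nonsingular n S \<longleftrightarrow>
     S \<in> carrier_mat n n \<and> (\<exists>T \<in> carrier_mat n n. S * T = 1\<^sub>m n \<and> T * S = 1\<^sub>m n)"
proof
  assume "nonsingular n S"
  then obtain T where S: "S \<in> carrier_mat n n" and T: "S * T = 1\<^sub>m n" "T * S = 1\<^sub>m (dim_row T)"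
    by (auto simp: nonsingular_def invertible_mat_def inverts_mat_def)
  have "dim_col T = n" using arg_cong[OF T(1), of dim_col] by simp
  moreover have "dim_row T = n" using arg_cong[OF T(2), of dim_col] S by simp
  ultimately show "S \<in> carrier_mat n n \<and> (\<exists>T \<in> carrier_mat n n. S * T = 1\<^sub>m n \<and> T * S = 1\<^sub>m n)"
    using S T by (metis carrier_matI)
next
  assume "S \<in> carrier_mat n n \<and> (\<exists>T \<in> carrier_mat n n. S * T = 1\<^sub>m n \<and> T * S = 1\<^sub>m n)"
  then show "nonsingular n S"
    by (auto simp: nonsingular_def invertible_mat_def inverts_mat_def square_mat.simps)
qed

lemma nonsingularI:
  "S \<in> carrier_mat n n \<Longrightarrow> T \<in> carrier_mat n n \<Longrightarrow> S * T = 1\<^sub>m n \<Longrightarrow> T * S = 1\<^sub>m n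
     \<Longrightarrow> nonsingular n S"
  by (auto simp: nonsingular_iff)

lemma nonsingular_carrier: "nonsingular n S \<Longrightarrow> S \<in> carrier_mat n n"
  by (simp add: nonsingular_iff)

lemma mult_cancel_inverse:
  fixes P Q Z :: "'a::semiring_1 mat"
  assumes "P \<in> carrier_mat n n" "Q \<in> carrier_mat n n" "P * Q = 1\<^sub>m n" "Z \<in> carrier_mat n m"
  shows "P * (Q * Z) = Z"
  using assms by (simp flip: assoc_mult_mat)

lemma nonsingular_mult:
  assumes "nonsingular n S" "nonsingular n R"
  shows "nonsingular n (S * R)"
proof -
  obtain S' R' where S: "S \<in> carrier_mat n n" "S' \<in> carrier_mat n n" "S * S' = 1\<^sub>m n" "S' * S = 1\<^sub>m n"
    and R: "R \<in> carrier_mat n n" "R' \<in> carrier_mat n n" "R * R' = 1\<^sub>m n" "R' * R = 1\<^sub>m n"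
    using assms by (auto simp: nonsingular_iff)
  have "(S * R) * (R' * S') = S * (R * (R' * S'))"
    using S R by (simp add: assoc_mult_mat[of _ n n _ n _ n])
  moreover have "(R' * S') * (S * R) = R' * (S' * (S * R))"
    using S R by (simp add: assoc_mult_mat[of _ n n _ n _ n])
  ultimately show ?thesis
    using S R by (intro nonsingularI[of _ _ "R' * S'"]) (simp_all add: mult_cancel_inverse[where n=n])
qed

section \<open>Involutions with eigenvalues 1 and -1\<close>

lemma sign_mat_carrier [simp]: "sign_mat p q \<in> carrier_mat (p + q) (p + q)"
  by (simp add: sign_mat_def direct_sum_def)

lemma sign_mat_dim [simp]: "dim_row (sign_mat p q) = p + q" "dim_col (sign_mat p q) = p + q"
  by (simp_all add: sign_mat_def direct_sum_def)

lemma sign_mat_carrier_le [simp]: "p \<le> n \<Longrightarrow> sign_mat p (n - p) \<in> carrier_mat n n"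
  using sign_mat_carrier[of p "n - p"] by simp

lemma sign_mat_index:
  "i < p + q \<Longrightarrow> j < p + q \<Longrightarrow>
     sign_mat p q $$ (i, j) = (if i = j then if i < p then 1 else -1 else 0)"
  by (auto simp: sign_mat_def direct_sum_def)

lemma sign_mult_index:
  assumes "C \<in> carrier_mat (p + q) m" "i < p + q" "j < m"
  shows "(sign_mat p q * C) $$ (i, j) = (if i < p then C $$ (i, j) else - C $$ (i, j))"
proof -
  have "(sign_mat p q * C) $$ (i, j)
      = (\<Sum>k\<in>{0..<p + q}. (if i = k then if i < p then 1 else -1 else 0) * C $$ (k, j))"
    using assms by (auto simp: scalar_prod_def sign_mat_index intro!: sum.cong)
  also have "\<dots> = (\<Sum>k\<in>{0..<p + q}. if i = k then if i < p then C $$ (i, j) else - C $$ (i, j) else 0)"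
    by (intro sum.cong) auto
  finally show ?thesis using assms by simp
qed

lemma mult_sign_index:
  assumes "C \<in> carrier_mat m (p + q)" "i < m" "j < p + q"
  shows "(C * sign_mat p q) $$ (i, j) = (if j < p then C $$ (i, j) else - C $$ (i, j))"
proof -
  have "(C * sign_mat p q) $$ (i, j)
      = (\<Sum>k\<in>{0..<p + q}. C $$ (i, k) * (if k = j then if k < p then 1 else -1 else 0))"
    using assms by (auto simp: scalar_prod_def sign_mat_index intro!: sum.cong)
  also have "\<dots> = (\<Sum>k\<in>{0..<p + q}. if k = j then if j < p then C $$ (i, j) else - C $$ (i, j) else 0)"
    by (intro sum.cong) auto
  finally show ?thesis using assms by simp
qed

text \<open>Conjugation with the sign matrix changes the sign of exactly the entries outside the two
diagonal blocks.\<close>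

lemma block_diagonal_iff_commutes_sign:
  fixes C :: "'a::division_ring mat"
  assumes "(2::'a) \<noteq> 0" "C \<in> carrier_mat (p + q) (p + q)"
  shows "block_diagonal p q C \<longleftrightarrow> sign_mat p q * C = C * sign_mat p q"
proof
  assume "block_diagonal p q C"
  then obtain A B where "A \<in> carrier_mat p p" "B \<in> carrier_mat q q" "C = direct_sum A B"
    by (auto simp: block_diagonal_def)
  then have off: "C $$ (i, j) = 0" if "i < p + q" "j < p + q" "(i < p) \<noteq> (j < p)" for i j
    using that by (auto simp: direct_sum_def)
  show "sign_mat p q * C = C * sign_mat p q"
  proof (intro eq_matI)
    fix i j assume "i < dim_row (C * sign_mat p q)" "j < dim_col (C * sign_mat p q)"
    then have ij: "i < p + q" "j < p + q" using assms(2) by auto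
    show "(sign_mat p q * C) $$ (i, j) = (C * sign_mat p q) $$ (i, j)"
      unfolding sign_mult_index[OF assms(2) ij] mult_sign_index[OF assms(2) ij]
      using off[OF ij] by auto
  qed (use assms(2) in auto)
next
  assume comm: "sign_mat p q * C = C * sign_mat p q"
  have off: "C $$ (i, j) = 0" if "i < p + q" "j < p + q" "(i < p) \<noteq> (j < p)" for i j
  proof -
    have "C $$ (i, j) = - C $$ (i, j)"
      using sign_mult_index[OF assms(2) that(1,2)] mult_sign_index[OF assms(2) that(1,2)] that(3)
      unfolding comm by (auto split: if_splits)
    then have "2 * C $$ (i, j) = 0" by (simp add: mult_2 eq_neg_iff_add_eq_0)
    then show ?thesis using assms(1) by simp
  qed
  have "C = direct_sum (mat p p (\<lambda>(i, j). C $$ (i, j))) (mat q q (\<lambda>(i, j). C $$ (p + i, p + j)))"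
    using assms(2) off by (intro eq_matI) (auto simp: direct_sum_def)
  then show "block_diagonal p q C"
    unfolding block_diagonal_def by (metis mat_carrier)
qed

lemma similar_mat_reindex:
  fixes G :: "'a::semiring_1 mat"
  assumes G: "G \<in> carrier_mat n n" and \<pi>: "\<And>i. i < n \<Longrightarrow> \<pi> i < n \<and> \<pi> (\<pi> i) = i"
  shows "similar_mat G (mat n n (\<lambda>(i, j). G $$ (\<pi> i, \<pi> j)))"
proof -
  define Q :: "'a mat" where "Q = mat n n (\<lambda>(i, j). if j = \<pi> i then 1 else 0)"
  have Q: "Q \<in> carrier_mat n n" by (simp add: Q_def)
  have QA: "(Q * A) $$ (i, j) = A $$ (\<pi> i, j)" if "A \<in> carrier_mat n n" "i < n" "j < n" for A i j
  proof -
    have "(Q * A) $$ (i, j) = (\<Sum>k\<in>{0..<n}. (if k = \<pi> i then 1 else 0) * A $$ (k, j))"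
      using that by (auto simp: Q_def scalar_prod_def intro!: sum.cong)
    also have "\<dots> = (\<Sum>k\<in>{0..<n}. if k = \<pi> i then A $$ (\<pi> i, j) else 0)"
      by (intro sum.cong) auto
    finally show ?thesis using \<pi>[OF that(2)] by simp
  qed
  have AQ: "(A * Q) $$ (i, j) = A $$ (i, \<pi> j)" if "A \<in> carrier_mat n n" "i < n" "j < n" for A i j
  proof -
    have "(A * Q) $$ (i, j) = (\<Sum>k\<in>{0..<n}. A $$ (i, k) * (if j = \<pi> k then 1 else 0))"
      using that by (auto simp: Q_def scalar_prod_def intro!: sum.cong)
    also have "\<dots> = (\<Sum>k\<in>{0..<n}. if k = \<pi> j then A $$ (i, \<pi> j) else 0)"
    proof (intro sum.cong refl)
      fix k assume "k \<in> {0..<n}"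
      then have "j = \<pi> k \<longleftrightarrow> k = \<pi> j" using \<pi>[of k] \<pi>[OF that(3)] by auto
      then show "A $$ (i, k) * (if j = \<pi> k then 1 else 0) = (if k = \<pi> j then A $$ (i, \<pi> j) else 0)"
        by simp
    qed
    finally show ?thesis using \<pi>[OF that(3)] by simp
  qed
  let ?G' = "mat n n (\<lambda>(i, j). G $$ (\<pi> i, \<pi> j))"
  have QQ: "Q * Q = 1\<^sub>m n"
  proof (intro eq_matI)
    fix i j assume ij: "i < dim_row (1\<^sub>m n :: 'a mat)" "j < dim_col (1\<^sub>m n :: 'a mat)"
    then have "(Q * Q) $$ (i, j) = Q $$ (\<pi> i, j)" by (intro QA Q) auto
    moreover have "\<pi> i < n" "\<pi> (\<pi> i) = i" using \<pi>[of i] ij by auto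
    ultimately show "(Q * Q) $$ (i, j) = 1\<^sub>m n $$ (i, j)"
      using ij by (auto simp: Q_def)
  qed (use Q in auto)
  have "G = Q * ?G' * Q"
  proof (intro eq_matI)
    fix i j assume ij: "i < dim_row (Q * ?G' * Q)" "j < dim_col (Q * ?G' * Q)"
    then have "i < n" "j < n" using Q by auto
    then have "(Q * ?G' * Q) $$ (i, j) = (Q * ?G') $$ (i, \<pi> j)"
      using Q by (intro AQ) auto
    also have "\<dots> = ?G' $$ (\<pi> i, \<pi> j)"
      using \<open>i < n\<close> \<open>j < n\<close> \<pi> by (intro QA) auto
    also have "\<dots> = G $$ (i, j)" using \<open>i < n\<close> \<open>j < n\<close> \<pi> by simp
    finally show "G $$ (i, j) = (Q * ?G' * Q) $$ (i, j)" by simp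
  qed (use Q G in auto)
  then show ?thesis
    using Q QQ G by (intro similar_matI[of _ _ Q Q n]) auto
qed

lemma similar_mat_square_one:
  assumes "similar_mat G H" "G \<in> carrier_mat n n" "G * G = 1\<^sub>m n"
  shows "H \<in> carrier_mat n n" "H * H = 1\<^sub>m n"
proof -
  from similar_matD[OF similar_mat_sym[OF assms(1)]] obtain k P Q
    where *: "{H, G, P, Q} \<subseteq> carrier_mat k k" "P * Q = 1\<^sub>m k" "Q * P = 1\<^sub>m k" "H = P * G * Q"
    by blast
  moreover have "k = n" using *(1) assms(2) by auto
  ultimately have PQ: "P * Q = 1\<^sub>m n" "Q * P = 1\<^sub>m n" "H = P * G * Q"
    "H \<in> carrier_mat n n" "P \<in> carrier_mat n n" "Q \<in> carrier_mat n n"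
    by auto
  show "H \<in> carrier_mat n n" by fact
  have "H * H = P * (G * (Q * (P * (G * Q))))"
    unfolding PQ(3) using PQ(5,6) assms(2) by (simp add: assoc_mult_mat[of _ n n _ n _ n])
  also have "\<dots> = P * (G * (G * Q))"
    using PQ assms(2) by (simp add: mult_cancel_inverse[where P=Q and Q=P and n=n and m=n])
  also have "\<dots> = 1\<^sub>m n"
    using PQ assms(2,3) by (simp add: mult_cancel_inverse[where P=G and Q=G and n=n and m=n])
  finally show "H * H = 1\<^sub>m n" .
qed

text \<open>The equations say that the column \<open>(1, w)\<close> is fixed. The change of basis that makes it the first
basis vector is a shear because its first entry is \<open>1\<close>.\<close>

lemma similar_mat_split_fixed_vector:
  fixes A :: "'a::ring_1 mat"
  assumes A: "A \<in> carrier_mat 1 1" and B: "B \<in> carrier_mat 1 n" and C: "C \<in> carrier_mat n 1"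
    and D: "D \<in> carrier_mat n n" and w: "w \<in> carrier_mat n 1"
    and fixed: "A + B * w = 1\<^sub>m 1" "C + D * w = w"
  shows "similar_mat (four_block_mat A B C D) (four_block_mat (1\<^sub>m 1) B (0\<^sub>m n 1) (D - w * B))"
proof -
  define P where "P = four_block_mat (1\<^sub>m 1) (0\<^sub>m 1 n) w (1\<^sub>m n)"
  define Q where "Q = four_block_mat (1\<^sub>m 1) (0\<^sub>m 1 n) (- w) (1\<^sub>m n)"
  note block = mult_four_block_mat[where ?nr1.0=1 and ?n1.0=1 and ?nr2.0=n and ?n2.0=n and ?nc1.0=1 and ?nc2.0=n]
  have wB: "w * B \<in> carrier_mat n n" using w B by simp
  have "P * Q = 1\<^sub>m (1 + n)"
    unfolding P_def Q_def using w
    by (subst block) (auto simp flip: four_block_one_mat simp del: One_nat_def intro!: cong_four_block_mat eq_matI)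
  moreover have "Q * P = 1\<^sub>m (1 + n)"
    unfolding P_def Q_def using w
    by (subst block) (auto simp flip: four_block_one_mat simp del: One_nat_def intro!: cong_four_block_mat eq_matI)
  moreover have "P * four_block_mat (1\<^sub>m 1) B (0\<^sub>m n 1) (D - w * B) * Q = four_block_mat A B C D"
  proof -
    have "P * four_block_mat (1\<^sub>m 1) B (0\<^sub>m n 1) (D - w * B) = four_block_mat (1\<^sub>m 1) B w D"
      unfolding P_def using w B D wB
      by (subst block) (auto intro!: cong_four_block_mat eq_matI)
    also have "\<dots> * Q = four_block_mat (1\<^sub>m 1 + B * (- w)) B (w + D * (- w)) D"
      unfolding Q_def using w B D
      by (subst block) (auto intro!: cong_four_block_mat)
    also have "\<dots> = four_block_mat A B C D"
    proof (intro cong_four_block_mat refl)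
      show "1\<^sub>m 1 + B * (- w) = A"
        unfolding fixed(1)[symmetric] using A B w by (intro eq_matI) auto
      have "w + D * (- w) = (C + D * w) + D * (- w)" by (simp only: fixed(2))
      also have "\<dots> = C" using C D w by (intro eq_matI) auto
      finally show "w + D * (- w) = C" .
    qed
    finally show ?thesis .
  qed
  ultimately show ?thesis
    using A B C D w wB by (intro similar_matI[of _ _ P Q "1 + n"]) (auto simp: P_def Q_def)
qed

text \<open>If \<open>x\<close> is the row of the shear that is used for conjugation, the block becomes
\<open>B + x - x H\<close>. As \<open>B H = - B\<close>, the choice \<open>x = - B / 2\<close> makes this zero.\<close>

lemma similar_mat_clear_block:
  fixes B :: "'a::division_ring mat"
  assumes two: "(2::'a) \<noteq> 0" and B: "B \<in> carrier_mat 1 n" and H: "H \<in> carrier_mat n n"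
    and BH: "B + B * H = 0\<^sub>m 1 n"
  shows "similar_mat (four_block_mat (1\<^sub>m 1) B (0\<^sub>m n 1) H)
    (four_block_mat (1\<^sub>m 1) (0\<^sub>m 1 n) (0\<^sub>m n 1) H)"
proof -
  define h where "h = inverse (2::'a)"
  have h: "h * x + h * x = x" for x
  proof -
    have "h * x + h * x = h * 2 * x" by (simp only: mult.assoc mult_2 distrib_left)
    then show ?thesis using two by (simp add: h_def del: inverse_eq_divide_numeral)
  qed
  define c where "c = h \<cdot>\<^sub>m B"
  define P where "P = four_block_mat (1\<^sub>m 1) (- c) (0\<^sub>m n 1) (1\<^sub>m n)"
  define Q where "Q = four_block_mat (1\<^sub>m 1) c (0\<^sub>m n 1) (1\<^sub>m n)"
  note block = mult_four_block_mat[where ?nr1.0=1 and ?n1.0=1 and ?nr2.0=n and ?n2.0=n and ?nc1.0=1 and ?nc2.0=n]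
  have c: "c \<in> carrier_mat 1 n" using B by (simp add: c_def)
  have cc: "c + c = B"
    by (intro eq_matI) (auto simp: c_def h)
  have cH: "c * H = - c"
  proof -
    have "c * H = h \<cdot>\<^sub>m (B * H)"
      unfolding c_def by (rule mult_smult_assoc_mat_noncomm[OF B H])
    also have "B * H = - B"
    proof (intro eq_matI)
      fix i j assume "i < dim_row (- B)" "j < dim_col (- B)"
      then show "(B * H) $$ (i, j) = (- B) $$ (i, j)"
        using arg_cong[OF BH, of "\<lambda>M. M $$ (i, j)"] B H
        by (auto simp: add_eq_0_iff simp del: index_mult_mat(1))
    qed (use B H in auto)
    also have "h \<cdot>\<^sub>m (- B) = - c"
      using B by (intro eq_matI) (auto simp: c_def)
    finally show ?thesis .
  qed
  have "P * Q = 1\<^sub>m (1 + n)"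
    unfolding P_def Q_def using c
    by (subst block) (auto simp flip: four_block_one_mat simp del: One_nat_def intro!: cong_four_block_mat eq_matI)
  moreover have "Q * P = 1\<^sub>m (1 + n)"
    unfolding P_def Q_def using c
    by (subst block) (auto simp flip: four_block_one_mat simp del: One_nat_def intro!: cong_four_block_mat eq_matI)
  moreover have "P * four_block_mat (1\<^sub>m 1) (0\<^sub>m 1 n) (0\<^sub>m n 1) H * Q
      = four_block_mat (1\<^sub>m 1) B (0\<^sub>m n 1) H"
  proof -
    have "P * four_block_mat (1\<^sub>m 1) (0\<^sub>m 1 n) (0\<^sub>m n 1) H = four_block_mat (1\<^sub>m 1) c (0\<^sub>m n 1) H"
      unfolding P_def using c H cH
      by (subst block) (auto intro!: cong_four_block_mat)
    also have "\<dots> * Q = four_block_mat (1\<^sub>m 1) (c + c) (0\<^sub>m n 1) H"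
      unfolding Q_def using c H
      by (subst block) (auto intro!: cong_four_block_mat)
    finally show ?thesis by (simp add: cc)
  qed
  ultimately show ?thesis
    using B H c by (intro similar_matI[of _ _ P Q "1 + n"]) (auto simp: P_def Q_def)
qed

text \<open>Splitting off a fixed column \<open>u\<close> of an involution \<open>G\<close>. The vanishing of the off-diagonal
block of the square is the equation that allows that block to be cleared.\<close>

lemma similar_mat_deflate:
  fixes G :: "'a::division_ring mat"
  assumes two: "(2::'a) \<noteq> 0" and G: "G \<in> carrier_mat (Suc n) (Suc n)" "G * G = 1\<^sub>m (Suc n)"
    and u: "u 0 = 1" "\<And>a. a < Suc n \<Longrightarrow> (\<Sum>k\<in>{0..<Suc n}. G $$ (a, k) * u k) = u a"
  shows "\<exists>H \<in> carrier_mat n n. H * H = 1\<^sub>m n \<and>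
    similar_mat G (four_block_mat (1\<^sub>m 1) (0\<^sub>m 1 n) (0\<^sub>m n 1) H)"
proof -
  obtain A B C D where split: "split_block G 1 1 = (A, B, C, D)"
    by (metis prod_cases4)
  note blocks = split_block[OF split, of n n]
  have c: "A \<in> carrier_mat 1 1" "B \<in> carrier_mat 1 n" "C \<in> carrier_mat n 1" "D \<in> carrier_mat n n"
    and GB: "G = four_block_mat A B C D"
    using blocks G(1) by simp_all
  define w where "w = mat n 1 (\<lambda>(k, _). u (Suc k))"
  have w: "w \<in> carrier_mat n 1" by (simp add: w_def)
  have fix1: "A + B * w = 1\<^sub>m 1"
  proof (intro eq_matI)
    fix i j assume ij: "i < dim_row (1\<^sub>m 1 :: 'a mat)" "j < dim_col (1\<^sub>m 1 :: 'a mat)"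
    have "(A + B * w) $$ (0, 0) = A $$ (0, 0) * u 0 + (\<Sum>k\<in>{0..<n}. B $$ (0, k) * u (Suc k))"
      using c w by (auto simp: scalar_prod_def w_def u(1) intro!: sum.cong)
    also have "\<dots> = (\<Sum>k\<in>{0..<Suc n}. G $$ (0, k) * u k)"
      unfolding sum.atLeast0_lessThan_Suc_shift GB using c by auto
    also have "\<dots> = 1" using u by simp
    finally show "(A + B * w) $$ (i, j) = 1\<^sub>m 1 $$ (i, j)" using ij by simp
  qed (use c w in auto)
  have fix2: "C + D * w = w"
  proof (intro eq_matI)
    fix i j assume "i < dim_row w" "j < dim_col w"
    then have ij: "i < n" "j = 0" using w by auto
    have "(C + D * w) $$ (i, 0) = C $$ (i, 0) * u 0 + (\<Sum>k\<in>{0..<n}. D $$ (i, k) * u (Suc k))"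
      using c w ij by (auto simp: scalar_prod_def w_def u(1) intro!: sum.cong)
    also have "\<dots> = (\<Sum>k\<in>{0..<Suc n}. G $$ (Suc i, k) * u k)"
      unfolding sum.atLeast0_lessThan_Suc_shift GB using c ij by auto
    also have "\<dots> = w $$ (i, 0)" using u(2)[of "Suc i"] ij by (simp add: w_def)
    finally show "(C + D * w) $$ (i, j) = w $$ (i, j)" using ij by simp
  qed (use c w in auto)
  define H where "H = D - w * B"
  have H: "H \<in> carrier_mat n n"
    unfolding H_def using mult_carrier_mat[OF w c(2)] by (rule minus_carrier_mat)
  have sim: "similar_mat G (four_block_mat (1\<^sub>m 1) B (0\<^sub>m n 1) H)" (is "similar_mat G ?T")
    unfolding GB H_def by (rule similar_mat_split_fixed_vector[OF c w fix1 fix2])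
  have "?T * ?T = 1\<^sub>m (Suc n)"
    using similar_mat_square_one[OF sim] G by auto
  also have "?T * ?T = four_block_mat (1\<^sub>m 1) (B + B * H) (0\<^sub>m n 1) (H * H)"
    using c H by (subst mult_four_block_mat[where ?nr1.0=1 and ?n1.0=1 and ?nr2.0=n and ?n2.0=n and ?nc1.0=1 and ?nc2.0=n])
      (auto intro!: cong_four_block_mat)
  finally have sq: "four_block_mat (1\<^sub>m 1) (B + B * H) (0\<^sub>m n 1) (H * H) = 1\<^sub>m (Suc n)" .
  have "B + B * H = 0\<^sub>m 1 n"
  proof (intro eq_matI)
    fix i j assume "i < dim_row (0\<^sub>m 1 n :: 'a mat)" "j < dim_col (0\<^sub>m 1 n :: 'a mat)"
    then have ij: "i = 0" "j < n" by auto
    have "(four_block_mat (1\<^sub>m 1) (B + B * H) (0\<^sub>m n 1) (H * H)) $$ (0, Suc j) = 0"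
      unfolding sq using ij by simp
    then show "(B + B * H) $$ (i, j) = 0\<^sub>m 1 n $$ (i, j)" using ij c H by simp
  qed (use c H in auto)
  moreover have "H * H = 1\<^sub>m n"
  proof (intro eq_matI)
    fix i j assume "i < dim_row (1\<^sub>m n :: 'a mat)" "j < dim_col (1\<^sub>m n :: 'a mat)"
    then have ij: "i < n" "j < n" by auto
    have "(four_block_mat (1\<^sub>m 1) (B + B * H) (0\<^sub>m n 1) (H * H)) $$ (Suc i, Suc j) = 1\<^sub>m n $$ (i, j)"
      unfolding sq using ij by simp
    then show "(H * H) $$ (i, j) = 1\<^sub>m n $$ (i, j)" using ij H by simp
  qed (use H in auto)
  ultimately show ?thesis
    using similar_mat_trans[OF sim similar_mat_clear_block[OF two c(2) H]] H by blast
qed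

text \<open>If \<open>1 + G\<close> is zero, \<open>G\<close> is already a sign matrix. Otherwise a nonzero column of \<open>1 + G\<close> is
fixed by \<open>G\<close> and can be split off. Only the eigenvalue \<open>1\<close> is ever split off, so the entries \<open>1\<close> come
first without any sorting.\<close>

theorem square_one_similar_to_sign:
  fixes G :: "'a::division_ring mat"
  assumes "(2::'a) \<noteq> 0" "G \<in> carrier_mat n n" "G * G = 1\<^sub>m n"
  shows "\<exists>p\<le>n. similar_mat G (sign_mat p (n - p))"
  using assms(2,3)
proof (induction n arbitrary: G)
  case 0
  then have "G = sign_mat 0 0"
    using sign_mat_carrier[of 0 0] by (intro eq_matI) auto
  then show ?case using similar_mat_refl[OF 0(1)] by auto
next
  case (Suc n)
  show ?case
  proof (cases "1\<^sub>m (Suc n) + G = 0\<^sub>m (Suc n) (Suc n)")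
    case True
    have "G = sign_mat 0 (Suc n)"
    proof (intro eq_matI)
      fix i j assume "i < dim_row (sign_mat 0 (Suc n) :: 'a mat)" "j < dim_col (sign_mat 0 (Suc n) :: 'a mat)"
      then have ij: "i < Suc n" "j < Suc n" by auto
      have "(1\<^sub>m (Suc n) + G) $$ (i, j) = 0" using True ij by simp
      then show "G $$ (i, j) = sign_mat 0 (Suc n) $$ (i, j)"
        using Suc.prems(1) ij by (auto simp: sign_mat_index add_eq_0_iff)
    qed (use Suc.prems(1) in auto)
    then show ?thesis using similar_mat_refl[OF Suc.prems(1)] by (intro exI[of _ 0]) simp
  next
    case False
    define E where "E = 1\<^sub>m (Suc n) + G"
    have E: "E \<in> carrier_mat (Suc n) (Suc n)" using Suc.prems(1) by (simp add: E_def)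
    obtain i j where ij: "i < Suc n" "j < Suc n" "E $$ (i, j) \<noteq> 0"
      using False E by (metis E_def carrier_matD eq_matI index_zero_mat)
    (* The columns of E are fixed by G; one of them is scaled to have first entry 1. *)
    have GE: "G * E = E"
      unfolding E_def using Suc.prems
      by (simp add: mult_add_distrib_mat[OF Suc.prems(1) one_carrier_mat Suc.prems(1)]
          comm_add_mat[OF Suc.prems(1)])
    (* Reindexing moves the nonzero entry to row 0. *)
    define \<pi> where "\<pi> = Transposition.transpose 0 i"
    have \<pi>: "\<pi> k < Suc n \<and> \<pi> (\<pi> k) = k" if "k < Suc n" for k
      using that ij(1) by (auto simp: \<pi>_def Transposition.transpose_def)
    have \<pi>0: "\<pi> 0 = i" by (simp add: \<pi>_def)
    define G1 where "G1 = mat (Suc n) (Suc n) (\<lambda>(a, b). G $$ (\<pi> a, \<pi> b))"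
    have sim1: "similar_mat G G1"
      unfolding G1_def by (rule similar_mat_reindex[OF Suc.prems(1) \<pi>])
    define u where "u k = E $$ (\<pi> k, j) * inverse (E $$ (i, j))" for k
    have "u 0 = 1" using ij(3) by (simp add: u_def \<pi>0)
    moreover have "(\<Sum>k\<in>{0..<Suc n}. G1 $$ (a, k) * u k) = u a" if a: "a < Suc n" for a
    proof -
      have "(\<Sum>k\<in>{0..<Suc n}. G1 $$ (a, k) * u k)
          = (\<Sum>k\<in>{0..<Suc n}. G $$ (\<pi> a, \<pi> k) * E $$ (\<pi> k, j)) * inverse (E $$ (i, j))"
        unfolding sum_distrib_right
        by (intro sum.cong) (use a in \<open>auto simp: G1_def u_def mult.assoc\<close>)
      also have "(\<Sum>k\<in>{0..<Suc n}. G $$ (\<pi> a, \<pi> k) * E $$ (\<pi> k, j))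
          = (\<Sum>k\<in>{0..<Suc n}. G $$ (\<pi> a, k) * E $$ (k, j))"
        by (rule sum.reindex_bij_witness[of _ \<pi> \<pi>]) (use \<pi> in auto)
      also have "\<dots> = (G * E) $$ (\<pi> a, j)"
        using Suc.prems(1) E \<pi>[OF a] ij(2) by (auto simp: scalar_prod_def)
      finally show ?thesis by (simp add: GE u_def)
    qed
    moreover note similar_mat_square_one[OF sim1 Suc.prems]
    ultimately obtain H where H: "H \<in> carrier_mat n n" "H * H = 1\<^sub>m n"
      and sim2: "similar_mat G1 (four_block_mat (1\<^sub>m 1) (0\<^sub>m 1 n) (0\<^sub>m n 1) H)"
      using similar_mat_deflate[OF assms(1), of G1 n u] by blast
    obtain p where p: "p \<le> n" "similar_mat H (sign_mat p (n - p))"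
      using Suc.IH[OF H] by blast
    have "similar_mat (four_block_mat (1\<^sub>m 1) (0\<^sub>m 1 n) (0\<^sub>m n 1) H)
        (four_block_mat (1\<^sub>m 1) (0\<^sub>m 1 n) (0\<^sub>m n 1) (sign_mat p (n - p)))"
      by (rule similar_mat_four_block_0_0[OF similar_mat_refl p(2) _ H(1)]) auto
    also have "four_block_mat (1\<^sub>m 1) (0\<^sub>m 1 n) (0\<^sub>m n 1) (sign_mat p (n - p))
        = (sign_mat (Suc p) (Suc n - Suc p) :: 'a mat)"
      using p(1) by (intro eq_matI) (auto simp: sign_mat_index)
    finally have "similar_mat G (sign_mat (Suc p) (Suc n - Suc p))"
      using sim1 sim2 similar_mat_trans by blast
    then show ?thesis using p(1) by blast
  qed
qed


section \<open>The conjugate transpose\<close>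

lemma conj_transpose_carrier [simp]:
  "conj_transpose \<sigma> A \<in> carrier_mat m n \<longleftrightarrow> A \<in> carrier_mat n m"
  by (simp add: conj_transpose_def)

lemma conj_transpose_dim [simp]:
  "dim_row (conj_transpose \<sigma> A) = dim_col A" "dim_col (conj_transpose \<sigma> A) = dim_row A"
  by (auto simp: conj_transpose_def)

lemma conj_transpose_index:
  "i < dim_col A \<Longrightarrow> j < dim_row A \<Longrightarrow> conj_transpose \<sigma> A $$ (i, j) = \<sigma> (A $$ (j, i))"
  by (auto simp: conj_transpose_def)

locale star_ring =
  fixes \<sigma> :: "'d::division_ring \<Rightarrow> 'd"
  assumes involution: "involution \<sigma>"
begin

lemma sigma_add: "\<sigma> (x + y) = \<sigma> x + \<sigma> y"
  and sigma_mult: "\<sigma> (x * y) = \<sigma> y * \<sigma> x"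
  and sigma_sigma [simp]: "\<sigma> (\<sigma> x) = x"
  using involution by (auto simp: involution_def)

lemma sigma_0 [simp]: "\<sigma> 0 = 0"
  using sigma_add[of 0 0] by (metis add_cancel_right_right)

lemma sigma_1 [simp]: "\<sigma> 1 = 1"
  using sigma_mult[of 1 "\<sigma> 1"] by simp

lemma sigma_minus: "\<sigma> (- x) = - \<sigma> x"
  using sigma_add[of x "- x"] by (simp add: eq_neg_iff_add_eq_0 add.commute)

lemma sigma_sum: "\<sigma> (sum f A) = (\<Sum>x\<in>A. \<sigma> (f x))"
  by (induction A rule: infinite_finite_induct) (auto simp: sigma_add)

abbreviation star :: "'d mat \<Rightarrow> 'd mat" where
  "star \<equiv> conj_transpose \<sigma>"

lemma star_mult:
  assumes "A \<in> carrier_mat nr n" "B \<in> carrier_mat n nc"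
  shows "star (A * B) = star B * star A"
proof (intro eq_matI)
  fix i j assume "i < dim_row (star B * star A)" "j < dim_col (star B * star A)"
  then have ij: "i < nc" "j < nr" using assms by auto
  have "star (A * B) $$ (i, j) = \<sigma> ((A * B) $$ (j, i))"
    using assms ij by (intro conj_transpose_index) auto
  also have "\<dots> = (\<Sum>k\<in>{0..<n}. \<sigma> (B $$ (k, i)) * \<sigma> (A $$ (j, k)))"
    using assms ij by (simp add: scalar_prod_def sigma_sum sigma_mult)
  also have "\<dots> = (star B * star A) $$ (i, j)"
    using assms ij by (auto simp: scalar_prod_def conj_transpose_index intro!: sum.cong)
  finally show "star (A * B) $$ (i, j) = (star B * star A) $$ (i, j)" .
qed (use assms in auto)

lemma star_add:
  "A \<in> carrier_mat n m \<Longrightarrow> B \<in> carrier_mat n m \<Longrightarrow> star (A + B) = star A + star B"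
  by (intro eq_matI) (auto simp: conj_transpose_index sigma_add)

lemma star_zero [simp]: "star (0\<^sub>m n m) = 0\<^sub>m m n"
  by (intro eq_matI) (auto simp: conj_transpose_index)

lemma star_one [simp]: "star (1\<^sub>m n) = 1\<^sub>m n"
  by (intro eq_matI) (auto simp: conj_transpose_index)

lemma star_sign: "star (sign_mat p q) = sign_mat p q"
  by (intro eq_matI) (auto simp: conj_transpose_index sign_mat_index sigma_minus)

end


section \<open>Polynomials in a matrix\<close>

text \<open>Here \<open>\<iota>\<close> embeds the fixed field of \<open>\<tau>\<close> into the centre of the skew field, with an image that
\<open>\<sigma>\<close> fixes pointwise, so that symmetric polynomials can be evaluated at matrices. It is a total
function, but a homomorphism only on the fixed field. The maps \<open>\<kappa> l\<close> for \<open>l < d\<close> are coordinates of the skew field over the fixed field, which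
make its dimension finite; matrices are therefore algebraic over the fixed field.\<close>

locale star_scalars = signed_sqrt_field \<tau> + star_ring \<sigma>
  for \<tau> :: "'k::alg_closed_field \<Rightarrow> 'k" and \<sigma> :: "'d::division_ring \<Rightarrow> 'd" +
  fixes \<iota> :: "'k \<Rightarrow> 'd" and \<kappa> :: "nat \<Rightarrow> 'd \<Rightarrow> 'k" and d :: nat
  assumes iota_add: "\<tau> a = a \<Longrightarrow> \<tau> b = b \<Longrightarrow> \<iota> (a + b) = \<iota> a + \<iota> b"
    and iota_mult: "\<tau> a = a \<Longrightarrow> \<tau> b = b \<Longrightarrow> \<iota> (a * b) = \<iota> a * \<iota> b"
    and iota_1: "\<iota> 1 = 1"
    and iota_central: "\<tau> a = a \<Longrightarrow> \<iota> a * x = x * \<iota> a"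
    and sigma_iota: "\<tau> a = a \<Longrightarrow> \<sigma> (\<iota> a) = \<iota> a"
    and kappa_fixed: "\<tau> (\<kappa> l x) = \<kappa> l x"
    and kappa_add: "\<kappa> l (x + y) = \<kappa> l x + \<kappa> l y"
    and kappa_mult: "\<tau> a = a \<Longrightarrow> \<kappa> l (\<iota> a * x) = a * \<kappa> l x"
    and kappa_inj: "(\<And>l. l < d \<Longrightarrow> \<kappa> l x = 0) \<Longrightarrow> x = 0"
begin

lemma iota_0: "\<iota> 0 = 0"
  using iota_add[of 0 0] by (metis add_cancel_right_right tau_0 add_0)

lemma two_neq_0_skew: "(2::'d) \<noteq> 0"
proof -
  have fixed2: "\<tau> 2 = 2" using tau_add[of 1 1] by simp
  have "\<iota> (1/2) * \<iota> 2 = \<iota> 1"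
    using iota_mult[OF tau_half fixed2] two_neq_0 by simp
  moreover have "\<iota> 2 = 2" using iota_add[of 1 1] iota_1 by simp
  ultimately show ?thesis using iota_1 by force
qed

text \<open>Horner evaluation. On symmetric polynomials it is a ring homomorphism, as their coefficients are
mapped to central elements.\<close>

definition eval_mat :: "nat \<Rightarrow> 'd mat \<Rightarrow> 'k poly \<Rightarrow> 'd mat" where
  "eval_mat n M p = fold_coeffs (\<lambda>a P. \<iota> a \<cdot>\<^sub>m 1\<^sub>m n + M * P) p (0\<^sub>m n n)"

context
  fixes n :: nat and M :: "'d mat"
  assumes M: "M \<in> carrier_mat n n"
begin

lemma iota_0_smult [simp]: "\<iota> 0 \<cdot>\<^sub>m A = 0\<^sub>m (dim_row A) (dim_col A)"
  by (intro eq_matI) (auto simp: iota_0)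

lemma eval_mat_0 [simp]: "eval_mat n M 0 = 0\<^sub>m n n"
  by (simp add: eval_mat_def)

lemma eval_mat_pCons: "eval_mat n M (pCons a p) = \<iota> a \<cdot>\<^sub>m 1\<^sub>m n + M * eval_mat n M p"
proof (cases "a = 0 \<and> p = 0")
  case True
  then show ?thesis using M by (auto simp: iota_0 intro!: eq_matI)
next
  case False
  then show ?thesis by (auto simp: eval_mat_def)
qed

lemma eval_mat_carrier [simp]: "eval_mat n M p \<in> carrier_mat n n"
  by (induction p) (use M in \<open>auto simp: eval_mat_pCons\<close>)

lemma eval_mat_dim [simp]: "dim_row (eval_mat n M p) = n" "dim_col (eval_mat n M p) = n"
  using eval_mat_carrier[of p] by (auto dest: carrier_matD simp del: eval_mat_carrier)

lemma eval_mat_add: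
  assumes "sym_poly p" "sym_poly q"
  shows "eval_mat n M (p + q) = eval_mat n M p + eval_mat n M q"
  using assms
proof (induction p arbitrary: q)
  case 0
  then show ?case by simp
next
  case (pCons a p)
  obtain b q' where q: "q = pCons b q'" by (cases q)
  have fixed: "\<tau> a = a" "\<tau> b = b" "sym_poly p" "sym_poly q'"
    using pCons.prems by (auto simp: sym_poly_pCons q)
  let ?P = "M * eval_mat n M p" and ?Q = "M * eval_mat n M q'"
  have PQ: "?P \<in> carrier_mat n n" "?Q \<in> carrier_mat n n" using M by auto
  have "eval_mat n M (pCons a p + q) = \<iota> (a + b) \<cdot>\<^sub>m 1\<^sub>m n + M * (eval_mat n M p + eval_mat n M q')"
    by (simp add: q eval_mat_pCons pCons.IH fixed)
  also have "\<dots> = (\<iota> a + \<iota> b) \<cdot>\<^sub>m 1\<^sub>m n + (?P + ?Q)"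
    using M by (simp add: iota_add fixed mult_add_distrib_mat[OF M eval_mat_carrier eval_mat_carrier])
  also have "\<dots> = (\<iota> a \<cdot>\<^sub>m 1\<^sub>m n + ?P) + (\<iota> b \<cdot>\<^sub>m 1\<^sub>m n + ?Q)"
    using PQ by (intro eq_matI) (auto simp: algebra_simps simp del: index_mult_mat(1))
  finally show ?case by (simp add: eval_mat_pCons q)
qed

lemma eval_mat_smult:
  assumes "\<tau> c = c" "sym_poly p"
  shows "eval_mat n M (smult c p) = \<iota> c \<cdot>\<^sub>m eval_mat n M p"
  using assms(2)
proof (induction p)
  case 0
  show ?case by simp
next
  case (pCons a p)
  have fixed: "\<tau> a = a" "sym_poly p" using pCons.prems by (auto simp: sym_poly_pCons)
  have "eval_mat n M (smult c (pCons a p)) = \<iota> (c * a) \<cdot>\<^sub>m 1\<^sub>m n + M * (\<iota> c \<cdot>\<^sub>m eval_mat n M p)"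
    by (simp add: eval_mat_pCons pCons.IH fixed)
  also have "M * (\<iota> c \<cdot>\<^sub>m eval_mat n M p) = \<iota> c \<cdot>\<^sub>m (M * eval_mat n M p)"
    by (rule mult_smult_distrib_central[OF iota_central[OF assms(1)] M eval_mat_carrier])
  also have "\<iota> (c * a) \<cdot>\<^sub>m 1\<^sub>m n + \<iota> c \<cdot>\<^sub>m (M * eval_mat n M p)
      = \<iota> c \<cdot>\<^sub>m (\<iota> a \<cdot>\<^sub>m 1\<^sub>m n + M * eval_mat n M p)"
    using M eval_mat_carrier[of p] iota_mult[OF assms(1) fixed(1)]
    by (intro eq_matI) (auto simp: algebra_simps simp del: index_mult_mat(1))
  finally show ?case by (simp add: eval_mat_pCons)
qed

lemma eval_mat_mult:
  assumes "sym_poly p" "sym_poly q"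
  shows "eval_mat n M (p * q) = eval_mat n M p * eval_mat n M q"
  using assms(1)
proof (induction p)
  case 0
  show ?case using left_mult_zero_mat[OF eval_mat_carrier[of q]] by simp
next
  case (pCons a p)
  have fixed: "\<tau> a = a" "sym_poly p" using pCons.prems by (auto simp: sym_poly_pCons)
  note c = eval_mat_carrier[of p] eval_mat_carrier[of q]
  have "eval_mat n M (pCons a p * q) = eval_mat n M (smult a q) + eval_mat n M (pCons 0 (p * q))"
    unfolding mult_pCons_left
    by (rule eval_mat_add) (simp_all add: sym_poly_smult sym_poly_mult sym_poly_pCons fixed assms(2))
  also have "eval_mat n M (pCons 0 (p * q)) = M * (eval_mat n M p * eval_mat n M q)"
    using M c by (auto simp: eval_mat_pCons iota_0 pCons.IH fixed(2) intro!: eq_matI)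
  also have "eval_mat n M (smult a q) = (\<iota> a \<cdot>\<^sub>m 1\<^sub>m n) * eval_mat n M q"
    using c by (simp add: eval_mat_smult[OF fixed(1) assms(2)]
        mult_smult_assoc_mat_noncomm[OF one_carrier_mat c(2)])
  also have "\<dots> + M * (eval_mat n M p * eval_mat n M q)
      = (\<iota> a \<cdot>\<^sub>m 1\<^sub>m n + M * eval_mat n M p) * eval_mat n M q"
    using M c
    by (simp add: add_mult_distrib_mat[where nr=n and n=n and nc=n] assoc_mult_mat[of _ n n _ n _ n])
  finally show ?case by (simp add: eval_mat_pCons)
qed

lemma eval_mat_1: "eval_mat n M 1 = 1\<^sub>m n"
  using M by (auto simp: one_pCons eval_mat_pCons iota_1 intro!: eq_matI)

lemma eval_mat_var: "eval_mat n M [:0, 1:] = M"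
proof -
  have "eval_mat n M [:0, 1:] = \<iota> 0 \<cdot>\<^sub>m 1\<^sub>m n + M * eval_mat n M 1"
    by (simp add: eval_mat_pCons one_pCons)
  then show ?thesis using M by (auto simp: eval_mat_1 iota_0 intro!: eq_matI)
qed

lemma eval_mat_dvd_diff:
  assumes "sym_poly m" "sym_poly p" "sym_poly q" "m dvd p - q" "m \<noteq> 0" "eval_mat n M m = 0\<^sub>m n n"
  shows "eval_mat n M p = eval_mat n M q"
proof -
  obtain r where r: "p - q = m * r" using assms(4) by (rule dvdE)
  have "sym_poly r"
    using sym_poly_quotient[OF assms(1) _ assms(5)] sym_poly_diff[OF assms(2,3)] r by simp
  have "p = q + m * r" using r by (simp add: algebra_simps)
  then have "eval_mat n M p = eval_mat n M q + eval_mat n M m * eval_mat n M r"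
    using eval_mat_add[OF assms(3) sym_poly_mult[OF assms(1) \<open>sym_poly r\<close>]]
      eval_mat_mult[OF assms(1) \<open>sym_poly r\<close>] by simp
  then show ?thesis
    using left_mult_zero_mat[OF eval_mat_carrier[of r]] by (simp add: assms(6))
qed

text \<open>The relation \<open>M A = A M\<^sup>*\<close> is inherited by every symmetric polynomial in \<open>M\<close>: the coefficients
are central and fixed by \<open>\<sigma>\<close>, and the powers of \<open>M\<close> commute with each other.\<close>

lemma eval_mat_intertwines:
  assumes "A \<in> carrier_mat n n" "M * A = A * star M" "sym_poly p"
  shows "eval_mat n M p * A = A * star (eval_mat n M p)"
  using assms(3)
proof (induction p)
  case 0
  show ?case using assms(1) by simp
next
  case (pCons a p)
  have fixed: "\<tau> a = a" "sym_poly p" using pCons.prems by (auto simp: sym_poly_pCons)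
  let ?P = "eval_mat n M p"
  have P: "?P \<in> carrier_mat n n" "star ?P \<in> carrier_mat n n" "star M \<in> carrier_mat n n"
    using M by auto
  have PM: "?P * M = M * ?P"
  proof -
    have "sym_poly [:0, 1:]" by (simp add: sym_poly_pCons)
    from eval_mat_mult[OF fixed(2) this] eval_mat_mult[OF this fixed(2)]
    show ?thesis by (simp only: eval_mat_var mult.commute)
  qed
  have star_scalar: "star (\<iota> a \<cdot>\<^sub>m 1\<^sub>m n) = \<iota> a \<cdot>\<^sub>m 1\<^sub>m n"
    by (intro eq_matI) (auto simp: conj_transpose_index sigma_iota[OF fixed(1)])
  have "star (eval_mat n M (pCons a p)) = \<iota> a \<cdot>\<^sub>m 1\<^sub>m n + star (M * ?P)"
    unfolding eval_mat_pCons using star_add[of "\<iota> a \<cdot>\<^sub>m 1\<^sub>m n" n n "M * ?P"] M P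
    by (simp add: star_scalar)
  also have "star (M * ?P) = star M * star ?P"
    unfolding PM[symmetric] by (rule star_mult[OF P(1) M])
  finally have "A * star (eval_mat n M (pCons a p))
      = A * (\<iota> a \<cdot>\<^sub>m 1\<^sub>m n) + A * (star M * star ?P)"
    using P assms(1) by (simp add: mult_add_distrib_mat[where nr=n and n=n and nc=n])
  also have "A * (\<iota> a \<cdot>\<^sub>m 1\<^sub>m n) = (\<iota> a \<cdot>\<^sub>m 1\<^sub>m n) * A"
    using assms(1) mult_smult_distrib_central[OF iota_central[OF fixed(1)] assms(1) one_carrier_mat]
      mult_smult_assoc_mat_noncomm[OF one_carrier_mat assms(1)] by simp
  also have "A * (star M * star ?P) = (A * star M) * star ?P"
    using assms(1) P by (simp add: assoc_mult_mat[of _ n n _ n _ n])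
  also have "\<dots> = M * (A * star ?P)"
    unfolding assms(2)[symmetric] using assms(1) P M by (simp add: assoc_mult_mat[of _ n n _ n _ n])
  also have "\<dots> = (M * ?P) * A"
    using pCons.IH[OF fixed(2)] M P assms(1) by (simp add: assoc_mult_mat[of _ n n _ n _ n])
  also have "(\<iota> a \<cdot>\<^sub>m 1\<^sub>m n) * A + (M * ?P) * A = eval_mat n M (pCons a p) * A"
    unfolding eval_mat_pCons using M P assms(1)
    by (simp add: add_mult_distrib_mat[where nr=n and n=n and nc=n])
  finally show ?case by simp
qed

text \<open>The coordinates of the entries of a polynomial in \<open>M\<close> are finitely many linear functionals of
the polynomial.\<close>

lemma annihilating_sym_poly_exists:
  "\<exists>m. sym_poly m \<and> m \<noteq> 0 \<and> eval_mat n M m = 0\<^sub>m n n"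
proof -
  define I where "I = {..<n} \<times> {..<n} \<times> {..<d}"
  define \<phi> where "\<phi> = (\<lambda>(i, j, l) p. if i < n \<and> j < n then \<kappa> l (eval_mat n M p $$ (i, j)) else 0)"
  have "\<exists>p. sym_poly p \<and> p \<noteq> 0 \<and> degree p \<ge> 0 \<and> (\<forall>i\<in>I. \<phi> i p = 0)"
  proof (rule functionals_vanish_on_sym_poly)
    show "finite I" by (simp add: I_def)
    show "\<tau> (\<phi> i p) = \<phi> i p" for i p
      by (auto simp: \<phi>_def kappa_fixed split: prod.splits)
    show "\<phi> i (p + q) = \<phi> i p + \<phi> i q" if "sym_poly p" "sym_poly q" for i p q
      by (auto simp: \<phi>_def eval_mat_add[OF that] kappa_add carrier_matD split: prod.splits)
    show "\<phi> i (smult c p) = c * \<phi> i p" if "\<tau> c = c" "sym_poly p" for i c p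
      by (auto simp: \<phi>_def eval_mat_smult[OF that] kappa_mult[OF that(1)] carrier_matD split: prod.splits)
  qed
  then obtain p where p: "sym_poly p" "p \<noteq> 0" "\<forall>i\<in>I. \<phi> i p = 0" by blast
  have "eval_mat n M p = 0\<^sub>m n n"
  proof (intro eq_matI)
    fix i j assume "i < dim_row (0\<^sub>m n n :: 'd mat)" "j < dim_col (0\<^sub>m n n :: 'd mat)"
    then have ij: "i < n" "j < n" by auto
    have "\<kappa> l (eval_mat n M p $$ (i, j)) = 0" if "l < d" for l
      using p(3) ij that by (auto simp: I_def \<phi>_def)
    then show "eval_mat n M p $$ (i, j) = 0\<^sub>m n n $$ (i, j)" using kappa_inj ij by simp
  qed (use eval_mat_carrier[of p] in auto)
  then show ?thesis using p by blast
qed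

text \<open>For invertible \<open>M\<close>, factors of the variable can be cancelled from an annihilating polynomial.\<close>

lemma annihilating_sym_poly_nonzero_at_0:
  assumes N: "N \<in> carrier_mat n n" "N * M = 1\<^sub>m n"
  shows "\<exists>m. sym_poly m \<and> m \<noteq> 0 \<and> poly m 0 \<noteq> 0 \<and> eval_mat n M m = 0\<^sub>m n n"
proof -
  have "\<exists>m'. sym_poly m' \<and> m' \<noteq> 0 \<and> poly m' 0 \<noteq> 0 \<and> eval_mat n M m' = 0\<^sub>m n n"
    if "sym_poly m" "m \<noteq> 0" "eval_mat n M m = 0\<^sub>m n n" for m
    using that
  proof (induction m)
    case (pCons a p)
    show ?case
    proof (cases "a = 0")
      case True
      have "M * eval_mat n M p = eval_mat n M (pCons a p)"
        using M eval_mat_carrier[of p] by (auto simp: eval_mat_pCons True iota_0 intro!: eq_matI)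
      then have "N * (M * eval_mat n M p) = 0\<^sub>m n n"
        using pCons.prems(3) N by simp
      then have "eval_mat n M p = 0\<^sub>m n n"
        using mult_cancel_inverse[OF N(1) M N(2) eval_mat_carrier] by simp
      then show ?thesis using pCons True by (auto simp: sym_poly_pCons)
    next
      case False
      then show ?thesis using pCons.prems by (intro exI[of _ "pCons a p"]) simp
    qed
  qed simp
  then show ?thesis using annihilating_sym_poly_exists by blast
qed

text \<open>With \<open>F\<close> and \<open>G\<close> the values of the two polynomials at \<open>M\<close>, one has \<open>F\<^sup>2 = G M\<close> and \<open>G\<^sup>2 = 1\<close>.
Hence \<open>M = F G F\<close>, and \<open>M A = F (G A) F\<^sup>*\<close> whenever \<open>M A = A M\<^sup>*\<close>.\<close>

lemma signed_sqrt_mat: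
  assumes N: "N \<in> carrier_mat n n" "N * M = 1\<^sub>m n" "M * N = 1\<^sub>m n"
  shows "\<exists>F G. nonsingular n F \<and> G \<in> carrier_mat n n \<and> G * G = 1\<^sub>m n \<and> M = F * (G * F) \<and>
    (\<forall>A\<in>carrier_mat n n. M * A = A * star M \<longrightarrow> F * A = A * star F \<and> G * A = A * star G)"
proof -
  obtain m where m: "sym_poly m" "m \<noteq> 0" "poly m 0 \<noteq> 0" "eval_mat n M m = 0\<^sub>m n n"
    using annihilating_sym_poly_nonzero_at_0[OF N(1,2)] by blast
  obtain f g where fg: "sym_poly f" "sym_poly g" "m dvd g * g - 1" "m dvd f * f - g * [:0, 1:]"
    using signed_sqrt_mod_poly[OF m(2,1,3)] by blast
  define F where "F = eval_mat n M f"
  define G where "G = eval_mat n M g"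
  have F: "F \<in> carrier_mat n n" and G: "G \<in> carrier_mat n n" by (simp_all add: F_def G_def)
  have GG: "G * G = 1\<^sub>m n"
    using eval_mat_dvd_diff[OF m(1) sym_poly_mult[OF fg(2,2)] sym_poly_1 fg(3) m(2,4)]
    by (simp add: eval_mat_mult[OF fg(2,2)] eval_mat_1 G_def)
  have symX: "sym_poly [:0, 1:]" by (simp add: sym_poly_pCons)
  have FF: "F * F = G * M"
    unfolding F_def G_def
    using eval_mat_dvd_diff[OF m(1) sym_poly_mult[OF fg(1,1)] sym_poly_mult[OF fg(2) symX] fg(4) m(2,4)]
    by (simp only: eval_mat_mult[OF fg(1,1)] eval_mat_mult[OF fg(2) symX] eval_mat_var)
  have FG: "F * G = G * F"
    using eval_mat_mult[OF fg(1,2)] eval_mat_mult[OF fg(2,1)]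
    by (simp add: F_def G_def mult.commute)
  have MG: "M * G = G * M"
    unfolding G_def using eval_mat_mult[OF symX fg(2)] eval_mat_mult[OF fg(2) symX]
    by (simp only: eval_mat_var mult.commute)
  note assoc = assoc_mult_mat[of _ n n _ n _ n]
  have "F * (G * F) = G * (F * F)"
    using assoc[OF F G F] assoc[OF G F F] by (simp only: FG)
  also have "\<dots> = M" unfolding FF by (rule mult_cancel_inverse[OF G G GG M])
  finally have MFGF: "F * (G * F) = M" .
  have "F * (G * (F * N)) = (F * (G * F)) * N"
    using F G N by (simp add: assoc)
  then have right: "F * (G * (F * N)) = 1\<^sub>m n" by (simp add: MFGF N(3))
  have "(N * (F * G)) * F = N * (F * (G * F))"
    using F G N by (simp add: assoc)
  then have left: "(N * (F * G)) * F = 1\<^sub>m n" by (simp add: MFGF N(2))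
  have "N * (F * G) = (N * (F * G)) * (F * (G * (F * N)))"
    using F G N by (simp add: right)
  also have "\<dots> = ((N * (F * G)) * F) * (G * (F * N))"
    using F G N by (simp add: assoc)
  finally have same: "N * (F * G) = G * (F * N)" using left F G N by simp
  have "nonsingular n F"
    using F G N right left same by (intro nonsingularI[of _ _ "G * (F * N)"]) auto
  moreover have "F * A = A * star F \<and> G * A = A * star G"
    if "A \<in> carrier_mat n n" "M * A = A * star M" for A
    unfolding F_def G_def using eval_mat_intertwines[OF that] fg(1,2) by blast
  ultimately show ?thesis
    using G GG MFGF by (intro exI[of _ F] exI[of _ G]) auto
qed

end

end


section \<open>Symmetric equivalence and congruence\<close>

context star_ring
begin

lemma congruence_mult:
  assumes "S \<in> carrier_mat n n" "R \<in> carrier_mat n n" "A \<in> carrier_mat n n"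
  shows "(S * R) * A * star (S * R) = S * (R * A * star R) * star S"
proof -
  have "star S \<in> carrier_mat n n" "star R \<in> carrier_mat n n" using assms by auto
  then show ?thesis
    using assms by (simp add: star_mult[OF assms(1,2)] assoc_mult_mat[of _ n n _ n _ n])
qed

text \<open>If \<open>S\<close> takes the first tuple to the blocks, \<open>J\<close> is the sign matrix and \<open>T\<close> takes the twisted blocks
to the second tuple, then \<open>T J S\<close> and \<open>T S\<close> witness the equivalence; they may be exchanged because
\<open>J\<close> commutes with the blocks.\<close>

lemma star_sym_equivalent_if_block_congruent:
  assumes "(2::'d) \<noteq> 0" "p \<le> n" "set As \<subseteq> carrier_mat n n"
    and "\<forall>C\<in>set Cs. block_diagonal p (n - p) C"
    and "star_congruent \<sigma> n As Cs"
    and "star_congruent \<sigma> n (lmult_tuple (sign_mat p (n - p)) Cs) Bs"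
  shows "star_sym_equivalent \<sigma> n As Bs"
proof -
  define J :: "'d mat" where "J = sign_mat p (n - p)"
  have J: "J \<in> carrier_mat n n" using assms(2) by (simp add: J_def)
  have "J * J = 1\<^sub>m n"
  proof (intro eq_matI)
    fix i j assume "i < dim_row (1\<^sub>m n :: 'd mat)" "j < dim_col (1\<^sub>m n :: 'd mat)"
    then have ij: "i < p + (n - p)" "j < n" using assms(2) by auto
    have "J * J = sign_mat p (n - p) * J" by (simp only: J_def)
    moreover have "J \<in> carrier_mat (p + (n - p)) n" using J assms(2) by simp
    ultimately have "(J * J) $$ (i, j) = (if i < p then J $$ (i, j) else - J $$ (i, j))"
      using sign_mult_index[OF _ ij, of J] by simp
    then show "(J * J) $$ (i, j) = 1\<^sub>m n $$ (i, j)"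
      using ij assms(2) by (auto simp: J_def sign_mat_index)
  qed (use J in auto)
  then have nJ: "nonsingular n J" using J by (intro nonsingularI[of _ _ J])
  obtain S T where S: "nonsingular n S" "mult_tuple S As (star S) = Cs"
    and T: "nonsingular n T" "mult_tuple T (lmult_tuple J Cs) (star T) = Bs"
    using assms(5,6) by (auto simp: star_congruent_def J_def)
  have c: "S \<in> carrier_mat n n" "T \<in> carrier_mat n n" "star S \<in> carrier_mat n n" "star T \<in> carrier_mat n n"
    using nonsingular_carrier[OF S(1)] nonsingular_carrier[OF T(1)] by auto
  have starJ: "star J = J" by (simp add: J_def star_sign)
  note assoc = assoc_mult_mat[of _ n n _ n _ n]
  have eq: "T * (J * S) * A * star (T * S) = T * (J * (S * A * star S)) * star T"
    "(T * S) * A * star (T * (J * S)) = T * (J * (S * A * star S)) * star T" if "A \<in> set As" for A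
  proof -
    have A: "A \<in> carrier_mat n n" using that assms(3) by auto
    define C where "C = S * A * star S"
    have C: "C \<in> carrier_mat n n" using c A by (simp add: C_def)
    have "C \<in> set Cs" unfolding S(2)[symmetric] C_def mult_tuple_def using that by auto
    then have JC: "J * C = C * J"
      using block_diagonal_iff_commutes_sign[OF assms(1), of C p "n - p"] assms(2,4) C
      by (simp add: J_def)
    show "T * (J * S) * A * star (T * S) = T * (J * (S * A * star S)) * star T"
      using c A J by (simp add: star_mult[OF c(2,1)] assoc)
    have "star (T * (J * S)) = star S * (J * star T)"
      using c J by (simp add: star_mult[where nr=n and n=n and nc=n] starJ assoc)
    then have "(T * S) * A * star (T * (J * S)) = T * (C * J) * star T"
      using c A J by (simp add: C_def assoc)
    then show "(T * S) * A * star (T * (J * S)) = T * (J * (S * A * star S)) * star T"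
      by (simp only: JC[symmetric]) (simp only: C_def)
  qed
  have Bs: "Bs = map (\<lambda>A. T * (J * (S * A * star S)) * star T) As"
    unfolding T(2)[symmetric] S(2)[symmetric] by (simp add: mult_tuple_def lmult_tuple_def)
  have "mult_tuple (T * (J * S)) As (star (T * S)) = Bs" "mult_tuple (T * S) As (star (T * (J * S))) = Bs"
    unfolding Bs mult_tuple_def using eq by auto
  then show ?thesis
    unfolding star_sym_equivalent_def using nonsingular_mult S(1) T(1) nJ by blast
qed

end

context star_scalars
begin

text \<open>For \<open>M = R\<^sup>-\<^sup>1 S\<close> the two equations of the equivalence say that \<open>S A R\<^sup>* = R (M A) R\<^sup>*\<close> and
\<open>M A = A M\<^sup>*\<close>. The signed square root of \<open>M\<close> absorbs \<open>M\<close> into the congruence, up to the involution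
\<open>G\<close>, and \<open>W = R F\<close>.\<close>

lemma star_sym_equivalent_imp_twisted_congruence:
  assumes "set As \<subseteq> carrier_mat n n" "star_sym_equivalent \<sigma> n As Bs"
  shows "\<exists>W G. nonsingular n W \<and> G \<in> carrier_mat n n \<and> G * G = 1\<^sub>m n \<and>
    (\<forall>A\<in>set As. G * A = A * star G) \<and> Bs = map (\<lambda>A. W * (G * A) * star W) As"
proof -
  obtain S R where SR: "nonsingular n S" "nonsingular n R"
    and B1: "mult_tuple S As (star R) = Bs" and B2: "mult_tuple R As (star S) = Bs"
    using assms(2) by (auto simp: star_sym_equivalent_def)
  obtain S' R' where S: "S \<in> carrier_mat n n" "S' \<in> carrier_mat n n" "S * S' = 1\<^sub>m n" "S' * S = 1\<^sub>m n"
    and R: "R \<in> carrier_mat n n" "R' \<in> carrier_mat n n" "R * R' = 1\<^sub>m n" "R' * R = 1\<^sub>m n"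
    using SR by (auto simp: nonsingular_iff)
  note assoc = assoc_mult_mat[of _ n n _ n _ n]
  define M where "M = R' * S"
  define N where "N = S' * R"
  have M: "M \<in> carrier_mat n n" and N: "N \<in> carrier_mat n n" using S R by (auto simp: M_def N_def)
  have "N * M = S' * (R * (R' * S))" using S R by (simp add: M_def N_def assoc)
  then have NM: "N * M = 1\<^sub>m n" using S by (simp add: mult_cancel_inverse[OF R(1,2,3) S(1)])
  have "M * N = R' * (S * (S' * R))" using S R by (simp add: M_def N_def assoc)
  then have MN: "M * N = 1\<^sub>m n" using R by (simp add: mult_cancel_inverse[OF S(1,2,3) R(1)])
  have RM: "R * M = S" unfolding M_def by (rule mult_cancel_inverse[OF R(1,2,3) S(1)])
  obtain F G where FG: "nonsingular n F" "G \<in> carrier_mat n n" "G * G = 1\<^sub>m n" "M = F * (G * F)"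
    "\<And>A. A \<in> carrier_mat n n \<Longrightarrow> M * A = A * star M \<Longrightarrow> F * A = A * star F \<and> G * A = A * star G"
    using signed_sqrt_mat[OF M N NM MN] by blast
  have F: "F \<in> carrier_mat n n" using FG(1) by (rule nonsingular_carrier)
  have c: "star R \<in> carrier_mat n n" "star S \<in> carrier_mat n n" "star R' \<in> carrier_mat n n"
    "star M \<in> carrier_mat n n" "star F \<in> carrier_mat n n"
    using S R M F by auto
  have starR: "star R * star R' = 1\<^sub>m n" using R by (simp flip: star_mult)
  have key: "G * A = A * star G" "S * A * star R = (R * F) * (G * A) * star (R * F)"
    if "A \<in> set As" for A
  proof -
    have A: "A \<in> carrier_mat n n" using that assms(1) by auto
    have "map (\<lambda>A. S * A * star R) As = map (\<lambda>A. R * A * star S) As"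
      using B1 B2 by (simp add: mult_tuple_def)
    then have eq: "S * A * star R = R * A * star S" using that by simp
    have "M * A = R' * ((S * A * star R) * star R')"
      using S R A c by (simp add: M_def assoc starR)
    also have "\<dots> = R' * ((R * A * (star M * star R)) * star R')"
      unfolding eq by (simp add: RM[symmetric] star_mult[OF R(1) M])
    also have "\<dots> = R' * (R * (A * star M))"
      using R A c by (simp add: assoc starR)
    also have "\<dots> = A * star M"
      by (rule mult_cancel_inverse[OF R(2,1,4)]) (use A c in auto)
    finally have MA: "M * A = A * star M" .
    from FG(5)[OF A this] have FA: "F * A = A * star F" and GA: "G * A = A * star G" by auto
    show "G * A = A * star G" by (rule GA)
    have "(R * F) * (G * A) * star (R * F) = R * (F * (G * (A * star F))) * star R"
      using R F FG(2) A c by (simp add: star_mult[OF R(1) F] assoc)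
    also have "\<dots> = R * (M * A) * star R"
      using F FG(2) A by (simp add: FG(4) assoc flip: FA)
    also have "\<dots> = S * A * star R"
      using R M A c by (simp add: assoc flip: RM)
    finally show "S * A * star R = (R * F) * (G * A) * star (R * F)" by simp
  qed
  show ?thesis
    using nonsingular_mult[OF SR(2) FG(1)] FG(2,3) key B1
    by (intro exI[of _ "R * F"] exI[of _ G]) (auto simp: mult_tuple_def)
qed

text \<open>A basis in which the involution \<open>G\<close> becomes a sign matrix turns the first tuple into a block
diagonal one, since \<open>G A = A G\<^sup>*\<close> then says that it commutes with the sign matrix.\<close>

theorem star_sym_equivalent_iff:
  assumes As: "As \<in> mat_tuples t n" and Bs: "Bs \<in> mat_tuples t n"
  shows "star_sym_equivalent \<sigma> n As Bs \<longleftrightarrow>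
    (\<exists>p \<in> {0..n}. \<exists>Cs \<in> mat_tuples t n. (\<forall>C \<in> set Cs. block_diagonal p (n - p) C) \<and>
       star_congruent \<sigma> n As Cs \<and>
       star_congruent \<sigma> n (lmult_tuple (sign_mat p (n - p)) Cs) Bs)"
    (is "_ \<longleftrightarrow> ?rhs")
proof
  have As': "set As \<subseteq> carrier_mat n n" using As by (simp add: mat_tuples_def)
  show "star_sym_equivalent \<sigma> n As Bs" if ?rhs
    using that star_sym_equivalent_if_block_congruent[OF two_neq_0_skew _ As'] by auto
  show ?rhs if equivalent: "star_sym_equivalent \<sigma> n As Bs"
  proof -
    obtain W G where W: "nonsingular n W" and G: "G \<in> carrier_mat n n" "G * G = 1\<^sub>m n"
      and "\<forall>A\<in>set As. G * A = A * star G"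
      and Bs_eq: "Bs = map (\<lambda>A. W * (G * A) * star W) As"
      using star_sym_equivalent_imp_twisted_congruence[OF As' equivalent] by blast
    then have GA: "G * A = A * star G" if "A \<in> set As" for A using that by blast
    obtain p where p: "p \<le> n" "similar_mat G (sign_mat p (n - p))"
      using square_one_similar_to_sign[OF two_neq_0_skew G] by blast
    define J :: "'d mat" where "J = sign_mat p (n - p)"
    have J: "J \<in> carrier_mat n n" using p(1) by (simp add: J_def)
    from similar_matD[OF p(2)] obtain k P Q
      where *: "{G, J, P, Q} \<subseteq> carrier_mat k k" "P * Q = 1\<^sub>m k" "Q * P = 1\<^sub>m k" "G = P * J * Q"
      unfolding J_def by blast
    moreover have "k = n" using *(1) G(1) by auto
    ultimately have PQ: "P * Q = 1\<^sub>m n" "Q * P = 1\<^sub>m n" "G = P * J * Q"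
      "P \<in> carrier_mat n n" "Q \<in> carrier_mat n n"
      by auto
    have nP: "nonsingular n P" and nQ: "nonsingular n Q"
      using PQ nonsingularI by blast+
    note assoc = assoc_mult_mat[of _ n n _ n _ n]
    have c: "star P \<in> carrier_mat n n" "star Q \<in> carrier_mat n n" "W \<in> carrier_mat n n"
      "star W \<in> carrier_mat n n" "star G \<in> carrier_mat n n"
      using PQ(4,5) G nonsingular_carrier[OF W] by auto
    have starG: "star G = star Q * (J * star P)"
      using PQ(4,5) J c
      by (simp add: PQ(3) star_mult[where nr=n and n=n and nc=n] assoc J_def star_sign)
    have starPQ: "star P * star Q = 1\<^sub>m n"
      using PQ by (simp flip: star_mult)
    define Cs where "Cs = mult_tuple Q As (star Q)"
    have left: "J * (Q * A * star Q) = Q * (G * A) * star Q" if "A \<in> set As" for A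
    proof -
      have A: "A \<in> carrier_mat n n" using that As' by auto
      have "Q * (G * A) * star Q = Q * (P * (J * (Q * (A * star Q))))"
        using PQ(4,5) J A c by (simp add: PQ(3) assoc)
      also have "\<dots> = J * (Q * (A * star Q))"
        by (rule mult_cancel_inverse[where m=n, OF PQ(5,4,2)]) (use PQ(5) J A c in simp)
      finally show ?thesis using PQ(5) A c by (simp add: assoc)
    qed
    have right: "(Q * A * star Q) * J = Q * (G * A) * star Q" if "A \<in> set As" for A
    proof -
      have A: "A \<in> carrier_mat n n" using that As' by auto
      have "Q * (G * A) * star Q = Q * (A * (star Q * (J * (star P * star Q))))"
        using PQ(5) J A c by (simp add: GA[OF that] starG assoc)
      then show ?thesis using PQ(5) J A c by (simp add: starPQ assoc)
    qed
    have "Cs \<in> mat_tuples t n"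
      using As PQ(5) c by (auto simp: mat_tuples_def Cs_def mult_tuple_def)
    moreover have "block_diagonal p (n - p) C" if C: "C \<in> set Cs" for C
    proof -
      obtain A where A: "A \<in> set As" "C = Q * A * star Q"
        using C by (auto simp: Cs_def mult_tuple_def)
      then have "C \<in> carrier_mat (p + (n - p)) (p + (n - p))"
        using As' PQ(5) c p(1) by auto
      then show ?thesis
        using block_diagonal_iff_commutes_sign[OF two_neq_0_skew] left[OF A(1)] right[OF A(1)] A(2)
        by (simp add: J_def)
    qed
    moreover have "star_congruent \<sigma> n As Cs"
      unfolding star_congruent_def Cs_def using nQ by blast
    moreover have "star_congruent \<sigma> n (lmult_tuple J Cs) Bs"
      unfolding star_congruent_def
    proof (intro exI conjI)
      show "nonsingular n (W * P)" by (rule nonsingular_mult[OF W nP])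
      have "(W * P) * (J * (Q * A * star Q)) * star (W * P) = W * (G * A) * star W"
        if A: "A \<in> set As" for A
      proof -
        have c': "A \<in> carrier_mat n n" "G * A \<in> carrier_mat n n" "Q * (G * A) * star Q \<in> carrier_mat n n"
          using A As' G c PQ(5) by auto
        have "(W * P) * (J * (Q * A * star Q)) * star (W * P)
            = W * (P * (Q * (G * A) * star Q) * star P) * star W"
          unfolding left[OF A] by (rule congruence_mult[OF c(3) PQ(4) c'(3)])
        also have "P * (Q * (G * A) * star Q) * star P = (P * Q) * (G * A) * star (P * Q)"
          by (rule congruence_mult[OF PQ(4,5) c'(2), symmetric])
        also have "\<dots> = G * A"
          by (simp add: PQ(1) left_mult_one_mat[OF c'(2)] right_mult_one_mat[OF c'(2)])
        finally show ?thesis .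
      qed
      then show "mult_tuple (W * P) (lmult_tuple J Cs) (star (W * P)) = Bs"
        by (simp add: Bs_eq Cs_def mult_tuple_def lmult_tuple_def)
    qed
    ultimately show ?thesis
      using p(1) unfolding J_def by (intro bexI[of _ p] bexI[of _ Cs]) auto
  qed
qed

end


section \<open>Nonidentity involutions of algebraically closed fields\<close>

text \<open>A fragment of the Artin-Schreier theorem, with its classical argument. In characteristic \<open>2\<close> there
would be \<open>a\<close> with \<open>\<tau> a = a + 1\<close>, and the trace of a root of \<open>y\<^sup>2 + y = a (a\<^sup>2 + a)\<close> would be a fixed
element among \<open>a\<close> and \<open>a + 1\<close>. In the other characteristics an imaginary unit \<open>j\<close> satisfies \<open>\<tau> j = - j\<close>: otherwise a
square root \<open>c\<close> of an element with \<open>\<tau> a = - a\<close> would have \<open>\<tau> (\<tau> c) = - c\<close>. So a square root \<open>s\<close> of a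
fixed element is either fixed or \<open>j s\<close> is fixed, the latter being a root of the negated element.\<close>

lemma signed_sqrt_field_nonidentity:
  fixes \<tau> :: "'k::alg_closed_field \<Rightarrow> 'k"
  assumes add: "\<And>x y. \<tau> (x + y) = \<tau> x + \<tau> y" and mult: "\<And>x y. \<tau> (x * y) = \<tau> x * \<tau> y"
    and inv: "\<And>x. \<tau> (\<tau> x) = x" and nonid: "\<tau> \<noteq> id"
  shows "signed_sqrt_field \<tau>"
proof -
  have tau0: "\<tau> 0 = 0" using add[of 0 0] by (metis add_cancel_right_right)
  have tau1: "\<tau> 1 = 1" using mult[of "\<tau> 1" 1] by (simp add: inv)
  have neg: "\<tau> (- x) = - \<tau> x" for x
    using add[of x "- x"] tau0 by (simp add: eq_neg_iff_add_eq_0 add.commute)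
  obtain b where b: "\<tau> b \<noteq> b" using nonid by (auto simp: fun_eq_iff)
  have two: "(2::'k) \<noteq> 0"
  proof
    assume "(2::'k) = 0"
    then have dbl: "x + x = 0" for x :: 'k by (metis mult_2 mult_zero_left)
    then have minus: "- x = x" for x :: 'k by (simp add: minus_unique)
    define u where "u = b + \<tau> b"
    have u: "\<tau> u = u" "u \<noteq> 0"
      using b minus by (auto simp: u_def add inv add.commute add_eq_0_iff)
    define a where "a = b * inverse u"
    have "\<tau> (inverse u) = inverse u"
    proof -
      have "u * \<tau> (inverse u) = 1" using mult[of u "inverse u"] u tau1 by simp
      then show ?thesis by (metis inverse_unique)
    qed
    then have "\<tau> a = (b + u) * inverse u"
      using dbl[of b] by (simp add: a_def mult u_def flip: add.assoc)
    then have ta: "\<tau> a = a + 1" using u(2) by (simp add: a_def distrib_right)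
    obtain y where "poly [:- (a * (a * a + a)), 1, 1:] y = 0"
      using alg_closed_imp_poly_has_root[of "[:- (a * (a * a + a)), 1, 1:]"] by auto
    then have y: "y * y + y = a * (a * a + a)"
      by (simp add: algebra_simps eq_neg_iff_add_eq_0)
    define z where "z = y + \<tau> y"
    have tz: "\<tau> z = z" by (simp add: z_def add inv add.commute)
    (* The trace z of y solves the same quadratic equation as a, so it is a or a + 1; but it is
       fixed by the involution, which exchanges these two. *)
    have "z * z + z = (y * y + y) + \<tau> (y * y + y) + (y * \<tau> y + y * \<tau> y)"
      by (simp add: z_def add mult algebra_simps)
    also have "\<dots> = a * (a * a + a) + (a + 1) * ((a + 1) * (a + 1) + (a + 1))"
      by (simp only: y dbl) (simp add: mult add ta)
    also have "\<dots> = a * a + a + ((a * a * a + a * a * a) + (a * a + a * a) + (a * a + a * a) + (a + a) + (a + a) + (1 + 1))"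
      by (simp add: algebra_simps)
    also have "\<dots> = a * a + a" by (simp only: dbl) simp
    finally have "z * z + z = a * a + a" .
    then have "(z - a) * (z + a + 1) = 0" by (simp add: algebra_simps)
    then have "z = a \<or> z = a + 1"
      by (metis add.assoc add_eq_0_iff minus right_minus_eq no_zero_divisors)
    moreover have "\<tau> (a + 1) = a" using dbl[of 1] by (simp add: add ta tau1 add.assoc)
    ultimately show False using tz ta by auto
  qed
  obtain j :: 'k where "j ^ 2 = - 1" using nth_root_exists[of 2 "-1"] by auto
  then have j: "j * j = - 1" by (simp add: power2_eq_square)
  have square_cases: "v = w \<or> v = - w" if "v * v = w * w" for v w :: 'k
    using that square_eq_iff by blast
  have "\<tau> j = - j"
  proof (rule ccontr)
    assume "\<tau> j \<noteq> - j"
    moreover have "\<tau> j * \<tau> j = j * j" using mult[of j j] j by (simp add: neg tau1)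
    ultimately have tj: "\<tau> j = j" using square_cases by blast
    define a where "a = b - \<tau> b"
    have ta: "\<tau> a = - a" using add[of b "- \<tau> b"] by (simp add: a_def neg inv)
    obtain c where "c ^ 2 = a" using nth_root_exists[of 2 a] by auto
    then have c: "c * c = a" by (simp add: power2_eq_square)
    have "\<tau> c * \<tau> c = - a" by (simp add: ta c flip: mult)
    also have "- a = (j * j) * (c * c)" by (simp add: j c)
    also have "\<dots> = (j * c) * (j * c)" by (simp add: mult_ac)
    finally have "\<tau> c = j * c \<or> \<tau> c = - (j * c)" by (rule square_cases)
    then have "\<tau> (\<tau> c) = (j * j) * c" by (auto simp: mult tj neg)
    then have "c = - 1 * c" by (simp only: inv j)
    then have "c + c = 0" by (metis mult_minus1 add.right_inverse)
    then have "2 * c = 0" by (simp only: mult_2)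
    then have "a = 0" using two c by auto
    then show False using b by (simp add: a_def)
  qed
  show ?thesis
  proof
    fix x assume x: "\<tau> x = x"
    obtain s where "s ^ 2 = x" using nth_root_exists[of 2 x] by auto
    then have s: "s * s = x" by (simp add: power2_eq_square)
    have "\<tau> s * \<tau> s = s * s" using mult[of s s] x s by simp
    then consider "\<tau> s = s" | "\<tau> s = - s" using square_cases by blast
    then show "\<exists>s e. \<tau> s = s \<and> (e = 1 \<or> e = -1) \<and> s * s = e * x"
    proof cases
      case 1
      then show ?thesis using s by (intro exI[of _ s] exI[of _ 1]) simp
    next
      case 2
      have "(j * s) * (j * s) = (j * j) * (s * s)" by (simp add: mult_ac)
      then have "(j * s) * (j * s) = -1 * x" by (simp add: j s)
      moreover have "\<tau> (j * s) = j * s" using 2 \<open>\<tau> j = - j\<close> by (simp add: mult)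
      ultimately show ?thesis by (intro exI[of _ "j * s"] exI[of _ "-1"]) simp
    qed
  qed (use add mult inv two in auto)
qed

lemma signed_sqrt_field_id:
  assumes "(2::'k::alg_closed_field) \<noteq> 0"
  shows "signed_sqrt_field (id :: 'k \<Rightarrow> 'k)"
proof
  fix x :: 'k
  obtain s where "s ^ 2 = x" using nth_root_exists[of 2 x] by auto
  then show "\<exists>s e. id s = s \<and> (e = 1 \<or> e = -1) \<and> s * s = e * x"
    by (intro exI[of _ s] exI[of _ 1]) (simp add: power2_eq_square)
qed (use assms in auto)


section \<open>The conjugation over a real closed field\<close>

text \<open>If \<open>1, a\<close> is a basis of the closure and \<open>a\<close> is a root of \<open>X\<^sup>2 - u X - v\<close>, the conjugation sends \<open>a\<close>
to the other root \<open>u - a\<close>. It moves \<open>a\<close>: the two roots can only coincide in characteristic \<open>2\<close> with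
\<open>u = 0\<close>, and then every square, hence every element, would lie in the base field.\<close>

lemma real_closed_conjugation:
  assumes "is_real_closed TYPE('b::field)"
  obtains \<tau> :: "'b::field alg_closure \<Rightarrow> 'b alg_closure" where
    "\<And>x y. \<tau> (x + y) = \<tau> x + \<tau> y" "\<And>x y. \<tau> (x * y) = \<tau> x * \<tau> y" "\<And>x. \<tau> (\<tau> x) = x"
    "\<And>x. \<tau> x = x \<longleftrightarrow> x \<in> range to_ac" "\<tau> \<noteq> id"
proof -
  interpret V: vector_space "ac_scale :: 'b \<Rightarrow> 'b alg_closure \<Rightarrow> 'b alg_closure"
    by (rule vector_space_ac_scale)
  obtain B :: "'b alg_closure set" where B: "V.independent B" "UNIV \<subseteq> V.span B" "card B = 2"
    using V.basis_exists[of UNIV] assms unfolding is_real_closed_def by metis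
  have "finite B" using B(3) by (metis card.infinite zero_neq_numeral)
  have span1: "V.span {1} = range to_ac"
    by (auto simp: V.span_singleton ac_scale_def)
  have "\<exists>a. a \<notin> range (to_ac :: 'b \<Rightarrow> _)"
  proof (rule ccontr)
    assume "\<not> ?thesis"
    then have "B \<subseteq> V.span {1}" unfolding span1 by auto
    then have "card B \<le> card {1 :: 'b alg_closure}"
      using V.independent_span_bound[OF _ B(1)] by blast
    then show False using B(3) by simp
  qed
  then obtain a where a: "a \<notin> range (to_ac :: 'b \<Rightarrow> _)" by blast
  have indep: "V.independent {a, 1}"
    using a by (intro V.independent_insertI) (auto simp: span1 V.independent_empty)
  have "\<exists>p q. x = to_ac p + to_ac q * a" for x
  proof -
    have "x \<in> V.span {a, 1}"
    proof (rule ccontr)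
      assume x: "x \<notin> V.span {a, 1}"
      then have "V.independent {x, a, 1}" by (rule V.independent_insertI[OF _ indep])
      then have "card {x, a, 1} \<le> card B"
        using V.independent_span_bound[OF \<open>finite B\<close>] B(2) by blast
      moreover have "x \<noteq> a" "x \<noteq> 1" using x V.span_base by auto
      moreover have "a \<noteq> 1" using a by (metis rangeI to_ac_1)
      ultimately show False using B(3) by simp
    qed
    then obtain q where "x - ac_scale q a \<in> range to_ac"
      using V.span_breakdown_eq[of x a "{1}"] span1 by auto
    then obtain p where "x - ac_scale q a = to_ac p" by blast
    then have "x = to_ac p + to_ac q * a" by (simp add: ac_scale_def algebra_simps)
    then show ?thesis by blast
  qed
  then obtain P Q where PQ: "\<And>x. x = to_ac (P x) + to_ac (Q x) * a" by metis
  have uniq: "p = p' \<and> q = q'" if eq: "to_ac p + to_ac q * a = to_ac p' + to_ac q' * a" for p q p' q'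
  proof -
    have "q = q'"
    proof (rule ccontr)
      assume "q \<noteq> q'"
      then have ne: "to_ac q - to_ac q' \<noteq> 0" by simp
      have "(to_ac q - to_ac q') * a = to_ac p' - to_ac p"
        using eq by (simp add: algebra_simps)
      then have "a = (to_ac p' - to_ac p) / (to_ac q - to_ac q')"
        using ne by (metis nonzero_mult_div_cancel_left)
      then have "a = to_ac ((p' - p) / (q - q'))" by simp
      then show False using a by blast
    qed
    then show ?thesis using eq by simp
  qed
  define u where "u = Q (a * a)"
  define v where "v = P (a * a)"
  have aa: "a * a = to_ac v + to_ac u * a" using PQ[of "a * a"] by (simp add: u_def v_def)
  define \<tau> where "\<tau> x = to_ac (P x) + to_ac (Q x) * (to_ac u - a)" for x
  have tau: "\<tau> (to_ac p + to_ac q * a) = to_ac p + to_ac q * (to_ac u - a)" for p q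
    using uniq[OF PQ[of "to_ac p + to_ac q * a"]] by (simp add: \<tau>_def)
  have "\<tau> (x + y) = \<tau> x + \<tau> y" for x y
  proof -
    have "x + y = to_ac (P x + P y) + to_ac (Q x + Q y) * a"
      using PQ[of x] PQ[of y] by (simp add: algebra_simps) 
    then have "\<tau> (x + y) = to_ac (P x + P y) + to_ac (Q x + Q y) * (to_ac u - a)"
      by (simp only: tau)
    then show ?thesis by (simp add: \<tau>_def algebra_simps)
  qed
  moreover have "\<tau> (x * y) = \<tau> x * \<tau> y" for x y
  proof -
    have "x * y = (to_ac (P x) + to_ac (Q x) * a) * (to_ac (P y) + to_ac (Q y) * a)"
      using PQ[of x] PQ[of y] by simp
    also have "\<dots> = to_ac (P x * P y) + to_ac (P x * Q y + Q x * P y) * a + to_ac (Q x * Q y) * (a * a)"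
      by (simp add: algebra_simps)
    also have "\<dots> = to_ac (P x * P y + Q x * Q y * v) + to_ac (P x * Q y + Q x * P y + Q x * Q y * u) * a"
      by (simp add: aa algebra_simps)
    finally have "\<tau> (x * y) = to_ac (P x * P y + Q x * Q y * v)
        + to_ac (P x * Q y + Q x * P y + Q x * Q y * u) * (to_ac u - a)"
      by (simp only: tau)
    also have "\<dots> = to_ac (P x * P y) + to_ac (P x * Q y + Q x * P y) * (to_ac u - a)
        + to_ac (Q x * Q y) * (to_ac v + to_ac u * (to_ac u - a))"
      by (simp add: algebra_simps)
    also have "to_ac v + to_ac u * (to_ac u - a) = (to_ac u - a) * (to_ac u - a)"
      by (simp add: algebra_simps aa)
    finally show ?thesis by (simp add: \<tau>_def algebra_simps)
  qed
  moreover have "\<tau> (\<tau> x) = x" for x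
  proof -
    have "\<tau> x = to_ac (P x + Q x * u) + to_ac (- Q x) * a" by (simp add: \<tau>_def algebra_simps)
    then have "\<tau> (\<tau> x) = to_ac (P x) + to_ac (Q x) * a" by (simp only: tau) (simp add: algebra_simps)
    then show ?thesis using PQ[of x] by simp
  qed
  moreover have not_twice: "to_ac u \<noteq> 2 * a"
  proof
    assume ua: "to_ac u = 2 * a"
    show False
    proof (cases "(2 :: 'b alg_closure) = 0")
      case True
      have dbl: "x + x = 0" for x :: "'b alg_closure" using True by (metis mult_2 mult_zero_left)
      have "to_ac u = 0" using ua True by simp
      then have aa': "a * a = to_ac v" using aa by simp
      obtain y where "y ^ 2 = a" using nth_root_exists[of 2 a] by auto
      then have "a = y * y" by (simp add: power2_eq_square)
      also have "\<dots> = (to_ac (P y) + to_ac (Q y) * a) * (to_ac (P y) + to_ac (Q y) * a)"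
        using PQ[of y] by simp
      also have "\<dots> = to_ac (P y * P y) + to_ac (Q y * Q y) * (a * a)
          + (to_ac (P y) * to_ac (Q y) * a + to_ac (P y) * to_ac (Q y) * a)"
        by (simp add: algebra_simps)
      also have "\<dots> = to_ac (P y * P y + Q y * Q y * v)" by (simp only: dbl aa') simp
      finally show False using a by blast
    next
      case False
      then have "a = to_ac u / 2" using ua by (metis nonzero_mult_div_cancel_left)
      then have "a = to_ac (u / 2)" by simp
      then show False using a by blast
    qed
  qed
  moreover have "\<tau> x = x \<longleftrightarrow> x \<in> range to_ac" for x
  proof
    assume "\<tau> x = x"
    then have "to_ac (P x) + to_ac (Q x) * (to_ac u - a) = to_ac (P x) + to_ac (Q x) * a"
      using PQ[of x] by (simp add: \<tau>_def)
    then have "to_ac (Q x) * (to_ac u - 2 * a) = 0" by (simp add: algebra_simps mult_2)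
    then have "Q x = 0" using not_twice by simp
    then have "x = to_ac (P x)" using PQ[of x] by simp
    then show "x \<in> range to_ac" by blast
  next
    assume "x \<in> range to_ac"
    then obtain p where "x = to_ac p" by blast
    then show "\<tau> x = x" using tau[of p 0] by simp
  qed
  moreover have "\<tau> \<noteq> id"
    using calculation(5) a by (metis id_apply)
  ultimately show ?thesis using that by blast
qed


section \<open>The four cases\<close>

lemma conj_transpose_id: "conj_transpose id A = transpose_mat A"
  by (intro eq_matI) (auto simp: conj_transpose_def)

lemma sym_equivalent_iff_star: "sym_equivalent n As Bs \<longleftrightarrow> star_sym_equivalent id n As Bs"
  by (simp add: sym_equivalent_def star_sym_equivalent_def conj_transpose_id)

lemma congruent_tuples_iff_star: "congruent_tuples n As Bs \<longleftrightarrow> star_congruent id n As Bs"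
  by (simp add: congruent_tuples_def star_congruent_def conj_transpose_id)

lemma involution_id: "involution (id :: 'a::field \<Rightarrow> 'a)"
  by (simp add: involution_def mult.commute)

lemma two_neq_zero_if_CHAR_neq_2:
  assumes "CHAR('a::field) \<noteq> 2"
  shows "(2::'a) \<noteq> 0"
proof
  assume "(2::'a) = 0"
  then have "of_nat 2 = (0::'a)" by simp
  then have "CHAR('a) dvd 2" by (simp only: of_nat_eq_0_iff_char_dvd)
  then have "CHAR('a) \<le> 2" "CHAR('a) \<noteq> 0" by (auto dest: dvd_imp_le intro!: Nat.gr0I)
  moreover have "CHAR('a) \<noteq> 1" by simp
  ultimately show False using assms by linarith
qed

text \<open>Here the involution \<open>G\<close> can be absorbed as well: over a field that contains a square root \<open>j\<close> of
\<open>-1\<close> it has the square root \<open>H = ((1 + j) + (1 - j) G) / 2\<close>, which intertwines the same matrices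
as \<open>G\<close>.\<close>

lemma sym_equivalent_iff_congruent:
  fixes As Bs :: "'a::alg_closed_field mat list"
  assumes two: "(2::'a) \<noteq> 0" and As: "set As \<subseteq> carrier_mat n n"
  shows "sym_equivalent n As Bs \<longleftrightarrow> congruent_tuples n As Bs"
proof
  assume "congruent_tuples n As Bs"
  then show "sym_equivalent n As Bs"
    unfolding congruent_tuples_def sym_equivalent_def by blast
next
  assume eqv: "sym_equivalent n As Bs"
  interpret signed_sqrt_field "id :: 'a \<Rightarrow> 'a" by (rule signed_sqrt_field_id[OF two])
  interpret star_scalars "id :: 'a \<Rightarrow> 'a" "id :: 'a \<Rightarrow> 'a" id "\<lambda>_. id" 1
    by unfold_locales (auto simp: involution_id)
  obtain W G where W: "nonsingular n W" and G: "G \<in> carrier_mat n n" "G * G = 1\<^sub>m n"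
    and GA: "\<forall>A\<in>set As. G * A = A * star G"
    and Bs: "Bs = map (\<lambda>A. W * (G * A) * star W) As"
    using star_sym_equivalent_imp_twisted_congruence[OF As] eqv
    unfolding sym_equivalent_iff_star by blast
  obtain j :: 'a where "j ^ 2 = - 1" using nth_root_exists[of 2 "-1"] by auto
  then have j: "j * j = - 1" by (simp add: power2_eq_square)
  define h :: 'a where "h = inverse 2"
  have h: "h + h = 1"
  proof -
    have "h + h = 2 * h" by (simp only: mult_2)
    then show ?thesis using two by (simp add: h_def del: inverse_eq_divide_numeral)
  qed
  define \<alpha> where "\<alpha> = h * (1 + j)"
  define \<beta> where "\<beta> = h * (1 - j)"
  define H where "H = \<alpha> \<cdot>\<^sub>m 1\<^sub>m n + \<beta> \<cdot>\<^sub>m G"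
  have H: "H \<in> carrier_mat n n" using G by (simp add: H_def)
  have "\<alpha> * \<alpha> + \<beta> * \<beta> = (h * h) * ((1 + j * j) + (1 + j * j))"
    by (simp add: \<alpha>_def \<beta>_def algebra_simps)
  then have ab1: "\<alpha> * \<alpha> + \<beta> * \<beta> = 0" by (simp add: j)
  have "\<alpha> * \<beta> + \<alpha> * \<beta> = (h * h) * ((1 - j * j) + (1 - j * j))"
    by (simp add: \<alpha>_def \<beta>_def algebra_simps)
  also have "\<dots> = (h + h) * (h + h)" by (simp only: j) (simp add: algebra_simps)
  finally have ab2: "\<alpha> * \<beta> + \<alpha> * \<beta> = 1" by (simp add: h)
  have "H * H = \<alpha> \<cdot>\<^sub>m H + \<beta> \<cdot>\<^sub>m (G * H)"
    using H G
    by (subst (1) H_def)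
      (simp add: add_mult_distrib_mat[where nr=n and n=n and nc=n] mult_smult_assoc_mat[where nr=n and n=n and nc=n])
  also have "G * H = \<alpha> \<cdot>\<^sub>m G + \<beta> \<cdot>\<^sub>m 1\<^sub>m n"
    using G
    by (simp add: H_def mult_add_distrib_mat[where nr=n and n=n and nc=n] mult_smult_distrib[where nr=n and n=n and nc=n])
  also have "\<alpha> \<cdot>\<^sub>m H + \<beta> \<cdot>\<^sub>m (\<alpha> \<cdot>\<^sub>m G + \<beta> \<cdot>\<^sub>m 1\<^sub>m n) = (\<alpha> * \<alpha> + \<beta> * \<beta>) \<cdot>\<^sub>m 1\<^sub>m n + (\<alpha> * \<beta> + \<alpha> * \<beta>) \<cdot>\<^sub>m G"
    using G by (intro eq_matI) (auto simp: H_def algebra_simps)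
  also have "\<dots> = G" unfolding ab1 ab2 using G by (intro eq_matI) auto
  finally have HH: "H * H = G" .
  note assoc = assoc_mult_mat[of _ n n _ n _ n]
  have "nonsingular n H"
  proof (rule nonsingularI[of _ _ "H * (H * H)"])
    have "H * (H * (H * H)) = (H * H) * (H * H)" using H by (simp add: assoc)
    then show "H * (H * (H * H)) = 1\<^sub>m n" by (simp add: HH G(2))
    have "H * (H * H) * H = (H * H) * (H * H)" using H by (simp add: assoc)
    then show "H * (H * H) * H = 1\<^sub>m n" by (simp add: HH G(2))
  qed (use H in auto)
  moreover have "W * H * A * star (W * H) = W * (G * A) * star W" if "A \<in> set As" for A
  proof -
    have A: "A \<in> carrier_mat n n" using As that by auto
    have c: "star G \<in> carrier_mat n n" "star H \<in> carrier_mat n n" using G H by auto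
    have "star H = \<alpha> \<cdot>\<^sub>m 1\<^sub>m n + \<beta> \<cdot>\<^sub>m star G"
      using G by (intro eq_matI) (auto simp: H_def conj_transpose_index)
    then have "A * star H = \<alpha> \<cdot>\<^sub>m A + \<beta> \<cdot>\<^sub>m (A * star G)"
      using A c
      by (simp add: mult_add_distrib_mat[where nr=n and n=n and nc=n] mult_smult_distrib[where nr=n and n=n and nc=n])
    also have "\<dots> = H * A"
      unfolding H_def using A G GA that
      by (simp add: add_mult_distrib_mat[where nr=n and n=n and nc=n] mult_smult_assoc_mat[where nr=n and n=n and nc=n])
    finally have AH: "A * star H = H * A" .
    have "H * A * star H = (H * H) * A" using H A c by (simp add: assoc AH)
    then show ?thesis
      using congruence_mult[OF nonsingular_carrier[OF W] H A] by (simp add: HH)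
  qed
  ultimately show "congruent_tuples n As Bs"
    unfolding congruent_tuples_iff_star star_congruent_def Bs mult_tuple_def
    using nonsingular_mult[OF W] by (intro exI[of _ "W * H"]) auto
qed

text \<open>Polynomials over a real closed field are the symmetric polynomials over its algebraic closure.\<close>

lemma star_scalars_real_closed:
  assumes "is_real_closed TYPE('b::field)"
  shows "\<exists>\<tau>. star_scalars \<tau> (id :: 'b \<Rightarrow> 'b) of_ac (\<lambda>_. to_ac) 1"
proof -
  obtain \<tau> :: "'b alg_closure \<Rightarrow> 'b alg_closure" where \<tau>:
    "\<And>x y. \<tau> (x + y) = \<tau> x + \<tau> y" "\<And>x y. \<tau> (x * y) = \<tau> x * \<tau> y" "\<And>x. \<tau> (\<tau> x) = x"
    "\<And>x. \<tau> x = x \<longleftrightarrow> x \<in> range to_ac" "\<tau> \<noteq> id"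
    by (rule real_closed_conjugation[OF assms]) blast
  interpret signed_sqrt_field \<tau>
    by (rule signed_sqrt_field_nonidentity) (use \<tau> in auto)
  have fixed: "\<exists>c. x = to_ac c" if "\<tau> x = x" for x using that \<tau>(4) by auto
  have "star_scalars \<tau> (id :: 'b \<Rightarrow> 'b) of_ac (\<lambda>_. to_ac) 1"
  proof
    show "involution (id :: 'b \<Rightarrow> 'b)" by (rule involution_id)
    show "of_ac (a + b) = (of_ac a + of_ac b :: 'b)" "of_ac (a * b) = (of_ac a * of_ac b :: 'b)"
      if "\<tau> a = a" "\<tau> b = b" for a b
      using that fixed by (metis of_ac_to_ac to_ac_add, metis of_ac_to_ac to_ac_mult)
    show "to_ac (of_ac a * x) = a * to_ac x" if "\<tau> a = a" for a x
      using that fixed by force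
    show "\<tau> (to_ac x) = to_ac x" for x using \<tau>(4) by blast
  qed (auto simp: mult.commute)
  then show ?thesis by blast
qed

text \<open>The field has dimension \<open>2\<close> over the fixed field of \<open>\<sigma>\<close>. The coordinates are the traces of \<open>x\<close>
and of \<open>a x\<close> for some \<open>a\<close> with \<open>\<sigma> a = - a\<close>, which are the real and imaginary parts up to
fixed factors.\<close>

lemma star_scalars_alg_closed:
  fixes \<sigma> :: "'c::alg_closed_field \<Rightarrow> 'c"
  assumes inv: "involution \<sigma>" and "\<sigma> \<noteq> id"
  shows "\<exists>\<kappa>. star_scalars \<sigma> \<sigma> id \<kappa> 2"
proof -
  interpret star_ring \<sigma> by unfold_locales (rule inv)
  interpret signed_sqrt_field \<sigma>
    by (rule signed_sqrt_field_nonidentity)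
      (use assms in \<open>auto simp: sigma_add sigma_mult mult.commute\<close>)
  obtain b where "\<sigma> b \<noteq> b" using assms(2) by (auto simp: fun_eq_iff)
  define a where "a = b - \<sigma> b"
  have "a \<noteq> 0" using \<open>\<sigma> b \<noteq> b\<close> by (simp add: a_def)
  have sa: "\<sigma> a = - a" using sigma_add[of b "- \<sigma> b"] by (simp add: a_def sigma_minus)
  have diff: "\<sigma> (x - y) = \<sigma> x - \<sigma> y" for x y
    using sigma_add[of x "- y"] by (simp add: sigma_minus)
  define \<kappa> :: "nat \<Rightarrow> 'c \<Rightarrow> 'c" where
    "\<kappa> l x = (if l = 0 then x + \<sigma> x else (x - \<sigma> x) * a)" for l x
  have "star_scalars \<sigma> \<sigma> id \<kappa> 2"
  proof
    show "\<sigma> (\<kappa> l x) = \<kappa> l x" for l x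
      by (simp add: \<kappa>_def sigma_add sigma_mult diff sa algebra_simps)
    show "\<kappa> l (x + y) = \<kappa> l x + \<kappa> l y" for l x y
      by (simp add: \<kappa>_def sigma_add algebra_simps)
    show "\<kappa> l (id c * x) = c * \<kappa> l x" if "\<sigma> c = c" for l c x
      using that by (simp add: \<kappa>_def sigma_mult algebra_simps)
    show "x = 0" if "\<And>l. l < 2 \<Longrightarrow> \<kappa> l x = 0" for x
    proof -
      have sum: "x + \<sigma> x = 0" using that[of 0] by (simp add: \<kappa>_def)
      have "x - \<sigma> x = 0" using that[of 1] \<open>a \<noteq> 0\<close> by (simp add: \<kappa>_def)
      then have "2 * x = 0" using sum by (simp only: mult_2) simp
      then show ?thesis using two_neq_0 by simp
    qed
  qed (auto simp: mult.commute)
  then show ?thesis by blast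
qed

text \<open>The involution maps the centre to itself, so it induces an automorphism of the real numbers of
order at most \<open>2\<close>. This is monotone because it preserves squares, and a monotone self-inverse map is
the identity.\<close>

lemma quat_involution_fixes_reals:
  assumes "involution \<sigma>"
  shows "\<sigma> (Quat r 0 0 0) = Quat r 0 0 0"
proof -
  interpret star_ring \<sigma> by unfold_locales (rule assms)
  have central: "\<exists>r. z = Quat r 0 0 0" if "\<And>w. z * w = w * z" for z :: quat
    using that[of "Quat 0 1 0 0"] that[of "Quat 0 0 1 0"]
    by (cases z) (simp add: times_quat_def)
  have "\<exists>s. \<sigma> (Quat r 0 0 0) = Quat s 0 0 0" for r
  proof (rule central)
    fix w
    have "Quat r 0 0 0 * \<sigma> w = \<sigma> w * Quat r 0 0 0"
      by (simp add: times_quat_def)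
    then have "\<sigma> (Quat r 0 0 0 * \<sigma> w) = \<sigma> (\<sigma> w * Quat r 0 0 0)" by simp
    then show "\<sigma> (Quat r 0 0 0) * w = w * \<sigma> (Quat r 0 0 0)"
      by (simp add: sigma_mult)
  qed
  then obtain h where h: "\<And>r. \<sigma> (Quat r 0 0 0) = Quat (h r) 0 0 0" by metis
  have hh: "h (h r) = r" for r
    using sigma_sigma[of "Quat r 0 0 0"] by (simp add: h)
  have hadd: "h (r + s) = h r + h s" for r s
    using sigma_add[of "Quat r 0 0 0" "Quat s 0 0 0"] by (simp add: h plus_quat_def)
  have hmult: "h (r * s) = h r * h s" for r s
    using sigma_mult[of "Quat r 0 0 0" "Quat s 0 0 0"] by (simp add: h times_quat_def)
  have mono: "h r \<le> h s" if "r \<le> s" for r s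
  proof -
    have "s = r + sqrt (s - r) * sqrt (s - r)" using that by simp
    then have "h s = h r + h (sqrt (s - r)) * h (sqrt (s - r))" by (metis hadd hmult)
    then show ?thesis by simp
  qed
  have "h r = r"
    using mono[of r "h r"] mono[of "h r" r] hh[of r] by linarith
  then show ?thesis by (simp add: h)
qed

text \<open>The fixed field is that of the real numbers inside the complex ones, whatever the involution of
the quaternions is. Reducing \<open>l\<close> modulo \<open>4\<close> only makes the coordinate maps total.\<close>

lemma star_scalars_quat:
  assumes "involution \<sigma>"
  shows "star_scalars cnj \<sigma> (\<lambda>z. Quat (Re z) 0 0 0)
    (\<lambda>l x. complex_of_real ([q_1 x, q_i x, q_j x, q_k x] ! (l mod 4))) 4"
proof -
  have "cnj \<i> \<noteq> id \<i>" by (simp add: complex_eq_iff)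
  then have "cnj \<noteq> id" by metis
  then interpret signed_sqrt_field cnj
    by (intro signed_sqrt_field_nonidentity) auto
  have real: "Im a = 0" if "cnj a = a" for a
    using that by (simp add: complex_eq_iff)
  have cases4: "P (l mod 4)" if "P 0" "P 1" "P 2" "P 3" for P and l :: nat
  proof -
    have "l mod 4 < 4" by simp
    then have "l mod 4 = 0 \<or> l mod 4 = 1 \<or> l mod 4 = 2 \<or> l mod 4 = 3" by linarith
    then show ?thesis using that by metis
  qed
  show ?thesis
  proof
    show "involution \<sigma>" by fact
    show "Quat (Re 1) 0 0 0 = 1" by (simp add: one_quat_def)
    show "Quat (Re (a + b)) 0 0 0 = Quat (Re a) 0 0 0 + Quat (Re b) 0 0 0" for a b
      by (simp add: plus_quat_def)
    show "Quat (Re (a * b)) 0 0 0 = Quat (Re a) 0 0 0 * Quat (Re b) 0 0 0" if "cnj a = a" for a b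
      using real[OF that] by (simp add: times_quat_def)
    show "Quat (Re a) 0 0 0 * x = x * Quat (Re a) 0 0 0" for a x
      by (simp add: times_quat_def)
    show "\<sigma> (Quat (Re a) 0 0 0) = Quat (Re a) 0 0 0" for a
      by (rule quat_involution_fixes_reals[OF assms])
    show "complex_of_real ([q_1 (x + y), q_i (x + y), q_j (x + y), q_k (x + y)] ! (l mod 4))
      = complex_of_real ([q_1 x, q_i x, q_j x, q_k x] ! (l mod 4))
      + complex_of_real ([q_1 y, q_i y, q_j y, q_k y] ! (l mod 4))" for l x y
      by (rule cases4[of _ l]) (simp_all add: plus_quat_def)
    show "complex_of_real ([q_1 (Quat (Re a) 0 0 0 * x), q_i (Quat (Re a) 0 0 0 * x),
        q_j (Quat (Re a) 0 0 0 * x), q_k (Quat (Re a) 0 0 0 * x)] ! (l mod 4))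
      = a * complex_of_real ([q_1 x, q_i x, q_j x, q_k x] ! (l mod 4))" if "cnj a = a" for l a x
      by (rule cases4[of _ l]) (simp_all add: times_quat_def complex_eq_iff real[OF that])
    show "x = 0" if "\<And>l. l < 4 \<Longrightarrow> complex_of_real ([q_1 x, q_i x, q_j x, q_k x] ! (l mod 4)) = 0" for x
      using that[of 0] that[of 1] that[of 2] that[of 3] by (cases x) (simp add: zero_quat_def)
  qed auto
qed

theorem theorem1:
  fixes n t :: nat
  shows
    "(CHAR('a::alg_closed_field) \<noteq> 2 \<longrightarrow>
       (\<forall>As \<in> mat_tuples t n. \<forall>Bs :: 'a mat list \<in> mat_tuples t n.
          sym_equivalent n As Bs \<longleftrightarrow> congruent_tuples n As Bs))
     \<and>
     (is_real_closed TYPE('b::field) \<longrightarrow>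
       (\<forall>As \<in> mat_tuples t n. \<forall>Bs :: 'b mat list \<in> mat_tuples t n.
          sym_equivalent n As Bs \<longleftrightarrow>
          (\<exists>p \<in> {0..n}. \<exists>Cs \<in> mat_tuples t n. (\<forall>C \<in> set Cs. block_diagonal p (n - p) C) \<and>
             congruent_tuples n As Cs \<and>
             congruent_tuples n (lmult_tuple (sign_mat p (n - p)) Cs) Bs)))
     \<and>
     (\<forall>\<sigma> :: 'c::alg_closed_field \<Rightarrow> 'c. involution \<sigma> \<and> \<sigma> \<noteq> id \<longrightarrow>
       (\<forall>As \<in> mat_tuples t n. \<forall>Bs \<in> mat_tuples t n.
          star_sym_equivalent \<sigma> n As Bs \<longleftrightarrow>
          (\<exists>p \<in> {0..n}. \<exists>Cs \<in> mat_tuples t n. (\<forall>C \<in> set Cs. block_diagonal p (n - p) C) \<and>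
             star_congruent \<sigma> n As Cs \<and>
             star_congruent \<sigma> n (lmult_tuple (sign_mat p (n - p)) Cs) Bs)))
     \<and>
     (\<forall>\<sigma> :: quat \<Rightarrow> quat. involution \<sigma> \<and> \<sigma> \<noteq> id \<longrightarrow>
       (\<forall>As \<in> mat_tuples t n. \<forall>Bs \<in> mat_tuples t n.
          star_sym_equivalent \<sigma> n As Bs \<longleftrightarrow>
          (\<exists>p \<in> {0..n}. \<exists>Cs \<in> mat_tuples t n. (\<forall>C \<in> set Cs. block_diagonal p (n - p) C) \<and>
             star_congruent \<sigma> n As Cs \<and>
             star_congruent \<sigma> n (lmult_tuple (sign_mat p (n - p)) Cs) Bs)))"
proof (intro conjI impI allI ballI)
  fix As Bs :: "'a mat list"
  assume "CHAR('a) \<noteq> 2" "As \<in> mat_tuples t n"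
  then show "sym_equivalent n As Bs \<longleftrightarrow> congruent_tuples n As Bs"
    by (intro sym_equivalent_iff_congruent two_neq_zero_if_CHAR_neq_2) (auto simp: mat_tuples_def)
next
  fix As Bs :: "'b mat list"
  assume "is_real_closed TYPE('b)" and ABs: "As \<in> mat_tuples t n" "Bs \<in> mat_tuples t n"
  then obtain \<tau> where "star_scalars \<tau> (id :: 'b \<Rightarrow> 'b) of_ac (\<lambda>_. to_ac) 1"
    using star_scalars_real_closed by blast
  from star_scalars.star_sym_equivalent_iff[OF this ABs]
  show "sym_equivalent n As Bs \<longleftrightarrow>
      (\<exists>p \<in> {0..n}. \<exists>Cs \<in> mat_tuples t n. (\<forall>C \<in> set Cs. block_diagonal p (n - p) C) \<and>
         congruent_tuples n As Cs \<and> congruent_tuples n (lmult_tuple (sign_mat p (n - p)) Cs) Bs)"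
    unfolding sym_equivalent_iff_star congruent_tuples_iff_star .
next
  fix \<sigma> :: "'c \<Rightarrow> 'c" and As Bs :: "'c mat list"
  assume \<sigma>: "involution \<sigma> \<and> \<sigma> \<noteq> id" and ABs: "As \<in> mat_tuples t n" "Bs \<in> mat_tuples t n"
  then obtain \<kappa> where "star_scalars \<sigma> \<sigma> id \<kappa> 2" using star_scalars_alg_closed by blast
  from star_scalars.star_sym_equivalent_iff[OF this ABs]
  show "star_sym_equivalent \<sigma> n As Bs \<longleftrightarrow>
      (\<exists>p \<in> {0..n}. \<exists>Cs \<in> mat_tuples t n. (\<forall>C \<in> set Cs. block_diagonal p (n - p) C) \<and>
         star_congruent \<sigma> n As Cs \<and> star_congruent \<sigma> n (lmult_tuple (sign_mat p (n - p)) Cs) Bs)" .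
next
  fix \<sigma> :: "quat \<Rightarrow> quat" and As Bs :: "quat mat list"
  assume \<sigma>: "involution \<sigma> \<and> \<sigma> \<noteq> id" and ABs: "As \<in> mat_tuples t n" "Bs \<in> mat_tuples t n"
  then have "involution \<sigma>" by blast
  from star_scalars.star_sym_equivalent_iff[OF star_scalars_quat[OF this] ABs]
  show "star_sym_equivalent \<sigma> n As Bs \<longleftrightarrow>
      (\<exists>p \<in> {0..n}. \<exists>Cs \<in> mat_tuples t n. (\<forall>C \<in> set Cs. block_diagonal p (n - p) C) \<and>
         star_congruent \<sigma> n As Cs \<and> star_congruent \<sigma> n (lmult_tuple (sign_mat p (n - p)) Cs) Bs)" .
qed

end
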